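(* Let $\sigma$ be any idempotent bijection (i.e. $\sigma\circ\sigma=\mathrm{id}$) of the index set $\{1,\dots,n+1\}$, with at most two fixed indices, and consider the submanifolds of the $A_n$ Ruijsenaars-Schneider phase space defined by $$\forall i:\quad q_i+q_{\sigma(i)}=0 \ \ (\mathrm{mod}\ T),\qquad \theta_i+\theta_{\sigma(i)}=0\ \ \left(\mathrm{mod}\ \tfrac{2i\pi}{\beta}\right),$$ where the rapidities of fixed indices are taken to be $0$ modulo $\frac{2i\pi}{\beta}$, and where, if there are two fixed indices $0$ and $\bar 0$, one has (up to permutation) $q_0=0$, $q_{\bar 0}=T/2$ modulo $T$. Endow these submanifolds with the symplectic form $\{\,\cdot\,,\cdot\,\}_{\rm rest}$ for which the conjugate variables are the restrictions of $\frac{1}{\sqrt2}(q_i-q_{\sigma(i)})$ and $\frac{1}{\sqrt2}(\theta_i-\theta_{\sigma(i)})$, for $i$ such that $\sigma(i)\neq i$ (one $i$ from each pair $\{i,\sigma(i)\}$). Then the Hamiltonians $\mathcal H_l=\frac{K_l+K_{-l}}{2}$, restricted to these submanifolds endowed with the symplectic form $\{\,\cdot\,,\cdot\,\}_{\rm rest}$, build an integrable hierarchy.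
   Context: The $A_n$ Ruijsenaars-Schneider hierarchy (hyperbolic case): the phase space has canonical variables $\theta_i$ (rapidities) and $q_i$ (positions), $i=1,\dots,n+1$, which are complex (imaginary shifts are allowed), with $\{\theta_i,q_j\}=\delta_{ij}$ and all other brackets of coordinates zero. With parameters $\beta,\nu,\gamma$, set $$f(q)=1-\frac{\sinh^2\gamma}{\sinh^2(\nu q/2)},\qquad T=\frac{2i\pi}{\nu};$$ $f$ is even and $T$-periodic, and square roots have their cut on the negative real axis. For a subset $I$ of the index set put $$\theta_I=\sum_{i\in I}\theta_i,\qquad f_I=\prod_{i\in I,\;k\notin I} f(q_i-q_k)^{1/2},\qquad h_l=\sum_{|I|=l}e^{-\beta\theta_I}f_I .$$ Define $$K_0=\frac{h_{n+1}+h_{n+1}^{-1}}{2},\qquad K_l=h_l,\qquad K_{-l}=\frac{h_{n+1-l}}{h_{n+1}}=\sum_{|I|=l}e^{\beta\theta_I}f_I\qquad \left(1\le l\le \left[\tfrac{n+1}{2}\right]\right),$$ and $\mathcal H_l=\frac{K_l+K_{-l}}{2}$ (so $\mathcal H_0=K_0$). The Hamiltonians $\mathcal H_l$ pairwise Poisson-commute on the full phase space, and the submanifolds above are invariant under the flows they generate. With more than two fixed indices the submanifold would lie in the singularity hyperplanes $q_i=q_j\ (\mathrm{mod}\ T)$, $i\ne j$, which are excluded. *)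

theory Defs
  imports "HOL-Analysis.Analysis"
begin

text \<open>Points of the phase space are pairs \<open>(q, \<theta>)\<close> of complex vectors over a finite index type
  \<open>'i\<close> with \<open>n + 1\<close> elements; the choice of \<open>'i\<close> instead of \<open>{1..n+1}\<close> is a relabelling.\<close>

type_synonym 'i phase = "(complex ^ 'i) \<times> (complex ^ 'i)"

definition congmod :: "complex \<Rightarrow> complex \<Rightarrow> complex \<Rightarrow> bool" where
  "congmod p x y \<longleftrightarrow> (\<exists>k::int. x - y = of_int k * p)"

definition rs_T :: "complex \<Rightarrow> complex" where
  "rs_T \<nu> = 2 * \<i> * of_real pi / \<nu>"

definition rs_f :: "complex \<Rightarrow> complex \<Rightarrow> complex \<Rightarrow> complex" where
  "rs_f \<nu> \<gamma> q = 1 - (sinh \<gamma>)\<^sup>2 / (sinh (\<nu> * q / 2))\<^sup>2"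

text \<open>\<open>csqrt\<close> is the principal root, with its cut on the negative real axis.\<close>

definition rs_fI :: "complex \<Rightarrow> complex \<Rightarrow> 'i::finite set \<Rightarrow> 'i phase \<Rightarrow> complex" where
  "rs_fI \<nu> \<gamma> I x = (\<Prod>i\<in>I. \<Prod>k\<in>- I. csqrt (rs_f \<nu> \<gamma> (fst x $ i - fst x $ k)))"

definition rs_h :: "complex \<Rightarrow> complex \<Rightarrow> complex \<Rightarrow> nat \<Rightarrow> 'i::finite phase \<Rightarrow> complex" where
  "rs_h \<beta> \<nu> \<gamma> l x =
     (\<Sum>I | card I = l. exp (- \<beta> * (\<Sum>i\<in>I. snd x $ i)) * rs_fI \<nu> \<gamma> I x)"

definition rs_K :: "complex \<Rightarrow> complex \<Rightarrow> complex \<Rightarrow> int \<Rightarrow> 'i::finite phase \<Rightarrow> complex" where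
  "rs_K \<beta> \<nu> \<gamma> l x =
     (if l = 0 then (rs_h \<beta> \<nu> \<gamma> CARD('i) x + inverse (rs_h \<beta> \<nu> \<gamma> CARD('i) x)) / 2
      else if l > 0 then rs_h \<beta> \<nu> \<gamma> (nat l) x
      else rs_h \<beta> \<nu> \<gamma> (CARD('i) - nat (- l)) x / rs_h \<beta> \<nu> \<gamma> CARD('i) x)"

definition rs_H :: "complex \<Rightarrow> complex \<Rightarrow> complex \<Rightarrow> nat \<Rightarrow> 'i::finite phase \<Rightarrow> complex" where
  "rs_H \<beta> \<nu> \<gamma> l x = (rs_K \<beta> \<nu> \<gamma> (int l) x + rs_K \<beta> \<nu> \<gamma> (- int l) x) / 2"

definition sigma_locus :: "complex \<Rightarrow> complex \<Rightarrow> ('i::finite \<Rightarrow> 'i) \<Rightarrow> 'i phase set" where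
  "sigma_locus \<beta> \<nu> \<sigma> = {(q, \<theta>).
     (\<forall>i. congmod (rs_T \<nu>) (q $ i + q $ \<sigma> i) 0) \<and>
     (\<forall>i. congmod (2 * \<i> * of_real pi / \<beta>) (\<theta> $ i + \<theta> $ \<sigma> i) 0) \<and>
     (\<forall>i. \<sigma> i = i \<longrightarrow> congmod (2 * \<i> * of_real pi / \<beta>) (\<theta> $ i) 0) \<and>
     (\<forall>i j. \<sigma> i = i \<and> \<sigma> j = j \<and> i \<noteq> j \<longrightarrow>
        congmod (rs_T \<nu>) (q $ i) 0 \<and> congmod (rs_T \<nu>) (q $ j) (rs_T \<nu> / 2) \<or>
        congmod (rs_T \<nu>) (q $ j) 0 \<and> congmod (rs_T \<nu>) (q $ i) (rs_T \<nu> / 2))}"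

text \<open>Besides the singularity hyperplanes, the points where the principal root of some
  \<open>f (q\<^sub>i - q\<^sub>k)\<close> is not holomorphic (its cut, and the zeros of \<open>f\<close>) are left out. Two fixed indices
  need not satisfy this: along the submanifold the corresponding factor is a constant,
  \<open>f (T/2) = cosh\<^sup>2 \<gamma>\<close>.\<close>

definition sigma_submanifold ::
    "complex \<Rightarrow> complex \<Rightarrow> complex \<Rightarrow> ('i::finite \<Rightarrow> 'i) \<Rightarrow> 'i phase set" where
  "sigma_submanifold \<beta> \<nu> \<gamma> \<sigma> = {x \<in> sigma_locus \<beta> \<nu> \<sigma>.
     (\<forall>i k. i \<noteq> k \<longrightarrow> \<not> congmod (rs_T \<nu>) (fst x $ i) (fst x $ k)) \<and>
     (\<forall>i k. i \<noteq> k \<and> \<not> (\<sigma> i = i \<and> \<sigma> k = k) \<longrightarrow>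
        rs_f \<nu> \<gamma> (fst x $ i - fst x $ k) \<notin> \<real>\<^sub>\<le>\<^sub>0)}"

text \<open>One index from each pair \<open>{i, \<sigma> i}\<close> with \<open>\<sigma> i \<noteq> i\<close>.\<close>

definition pair_representatives :: "('i \<Rightarrow> 'i) \<Rightarrow> 'i set \<Rightarrow> bool" where
  "pair_representatives \<sigma> R \<longleftrightarrow> R \<inter> \<sigma> ` R = {} \<and> R \<union> \<sigma> ` R = {i. \<sigma> i \<noteq> i}"

definition rest_coord :: "('i::finite \<Rightarrow> 'i) \<Rightarrow> 'i \<Rightarrow> complex ^ 'i \<Rightarrow> complex" where
  "rest_coord \<sigma> i v = (v $ i - v $ \<sigma> i) / of_real (sqrt 2)"

text \<open>The coordinates on the submanifold are \<open>Q\<^sub>i = rest_coord \<sigma> i q\<close> and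
  \<open>P\<^sub>i = rest_coord \<sigma> i \<theta>\<close> for representatives \<open>i\<close>. Adding \<open>rest_shift \<sigma> i s\<close> to \<open>q\<close> (to \<open>\<theta>\<close>)
  stays in \<open>sigma_locus \<beta> \<nu> \<sigma>\<close>, changes \<open>Q\<^sub>i\<close> (\<open>P\<^sub>i\<close>) by \<open>s\<close> and no other coordinate (the next two
  lemmas), so that the derivatives along it are the coordinate derivatives on the submanifold.\<close>

definition rest_shift :: "('i::finite \<Rightarrow> 'i) \<Rightarrow> 'i \<Rightarrow> complex \<Rightarrow> complex ^ 'i" where
  "rest_shift \<sigma> i s =
     (\<chi> j. if j = i then s / of_real (sqrt 2) else if j = \<sigma> i then - s / of_real (sqrt 2) else 0)"

lemma rest_coord_shift:
  assumes "\<sigma> \<circ> \<sigma> = id" "pair_representatives \<sigma> R" "i \<in> R" "j \<in> R"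
  shows "rest_coord \<sigma> j (v + rest_shift \<sigma> i s) = rest_coord \<sigma> j v + (if j = i then s else 0)"
proof -
  have inv: "\<sigma> (\<sigma> k) = k" for k
    using assms(1) by (metis comp_apply id_apply)
  have ne: "\<sigma> i \<noteq> i" "j \<noteq> \<sigma> i" "\<sigma> j \<noteq> i"
    using assms(2-4) by (auto simp: pair_representatives_def)
  have sq: "complex_of_real (sqrt 2) * complex_of_real (sqrt 2) = 2"
    by (simp flip: of_real_mult)
  have half: "2 * s / of_real (sqrt 2) / of_real (sqrt 2) = s"
    by (simp add: sq)
  have "\<sigma> j = \<sigma> i \<longleftrightarrow> j = i"
    using inv by metis
  then have "rest_coord \<sigma> j (rest_shift \<sigma> i s) = (if j = i then s else 0)"
    using ne half
    by (auto simp: rest_coord_def rest_shift_def diff_divide_distrib simp del: divide_divide_eq_left)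
  then show ?thesis
    by (simp add: rest_coord_def add_divide_distrib diff_divide_distrib)
qed

lemma rest_shift_in_locus:
  assumes "\<sigma> \<circ> \<sigma> = id" "\<sigma> i \<noteq> i" "x \<in> sigma_locus \<beta> \<nu> \<sigma>"
  shows "(fst x + rest_shift \<sigma> i s, snd x + rest_shift \<sigma> i t) \<in> sigma_locus \<beta> \<nu> \<sigma>"
proof -
  have inv: "\<sigma> (\<sigma> k) = k" for k
    using assms(1) by (metis comp_apply id_apply)
  have sum0: "rest_shift \<sigma> i r $ k + rest_shift \<sigma> i r $ \<sigma> k = 0" for k r
    using inv[of k] inv[of i] assms(2) by (auto simp: rest_shift_def)
  have fixed: "(v + rest_shift \<sigma> i r) $ k = v $ k" if "\<sigma> k = k" for v k r
    using that inv[of i] assms(2) by (auto simp: rest_shift_def)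
  have shift: "(v + rest_shift \<sigma> i r) $ k + (v + rest_shift \<sigma> i r) $ \<sigma> k = v $ k + v $ \<sigma> k"
    for v k r
    using sum0[of r k] by (simp add: algebra_simps add_eq_0_iff2)
  show ?thesis
    using assms(3) unfolding sigma_locus_def mem_Collect_eq case_prod_beta fst_conv snd_conv shift
    by (simp only: fixed cong: conj_cong imp_cong) (metis fixed)
qed

definition dQ :: "('i::finite \<Rightarrow> 'i) \<Rightarrow> 'i \<Rightarrow> ('i phase \<Rightarrow> complex) \<Rightarrow> 'i phase \<Rightarrow> complex" where
  "dQ \<sigma> i F x = deriv (\<lambda>s. F (fst x + rest_shift \<sigma> i s, snd x)) 0"

definition dP :: "('i::finite \<Rightarrow> 'i) \<Rightarrow> 'i \<Rightarrow> ('i phase \<Rightarrow> complex) \<Rightarrow> 'i phase \<Rightarrow> complex" where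
  "dP \<sigma> i F x = deriv (\<lambda>s. F (fst x, snd x + rest_shift \<sigma> i s)) 0"

text \<open>The sign is that of \<open>{\<theta>\<^sub>i, q\<^sub>j} = \<delta>\<^sub>i\<^sub>j\<close>, i.e. \<open>{P\<^sub>i, Q\<^sub>j} = \<delta>\<^sub>i\<^sub>j\<close>.\<close>

definition rest_bracket ::
    "('i::finite \<Rightarrow> 'i) \<Rightarrow> 'i set \<Rightarrow> ('i phase \<Rightarrow> complex) \<Rightarrow> ('i phase \<Rightarrow> complex) \<Rightarrow> 'i phase \<Rightarrow> complex"
  where
  "rest_bracket \<sigma> R F G x = (\<Sum>i\<in>R. dP \<sigma> i F x * dQ \<sigma> i G x - dQ \<sigma> i F x * dP \<sigma> i G x)"

text \<open>Complex differentiability of the restriction of \<open>F\<close> to \<open>M\<close>: a real Frechet derivative that is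
  complex linear.\<close>

definition holomorphic_on_submanifold :: "('i::finite phase \<Rightarrow> complex) \<Rightarrow> 'i phase set \<Rightarrow> bool" where
  "holomorphic_on_submanifold F M \<longleftrightarrow>
     (\<forall>x\<in>M. \<exists>D. (F has_derivative D) (at x within M) \<and>
        (\<forall>c u v. D (c *s u, c *s v) = c * D (u, v)))"

text \<open>Linear independence at \<open>x\<close> of the differentials of the restrictions of \<open>F l\<close>, \<open>l \<in> S\<close>,
  written in the coordinates \<open>Q\<^sub>i, P\<^sub>i\<close>.\<close>

definition differentials_independent ::
    "('i::finite \<Rightarrow> 'i) \<Rightarrow> 'i set \<Rightarrow> (nat \<Rightarrow> 'i phase \<Rightarrow> complex) \<Rightarrow> nat set \<Rightarrow> 'i phase \<Rightarrow> bool" where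
  "differentials_independent \<sigma> R F S x \<longleftrightarrow>
     (\<forall>c. (\<forall>i\<in>R. (\<Sum>l\<in>S. c l * dQ \<sigma> i (F l) x) = 0 \<and> (\<Sum>l\<in>S. c l * dP \<sigma> i (F l) x) = 0)
        \<longrightarrow> (\<forall>l\<in>S. c l = 0))"

text \<open>Liouville integrability on \<open>M\<close>, whose dimension is \<open>2 * card R\<close>: the functions are in
  involution, and \<open>card R\<close> of them are independent on an open dense subset.\<close>

definition integrable_hierarchy ::
    "('i::finite \<Rightarrow> 'i) \<Rightarrow> 'i set \<Rightarrow> 'i phase set \<Rightarrow> (nat \<Rightarrow> 'i phase \<Rightarrow> complex) \<Rightarrow> nat set \<Rightarrow> bool"
  where
  "integrable_hierarchy \<sigma> R M F L \<longleftrightarrow>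
     (\<forall>l\<in>L. holomorphic_on_submanifold (F l) M) \<and>
     (\<forall>k\<in>L. \<forall>l\<in>L. \<forall>x\<in>M. rest_bracket \<sigma> R (F k) (F l) x = 0) \<and>
     (\<exists>S\<subseteq>L. card S = card R \<and>
        (\<exists>U. openin (top_of_set M) U \<and> M \<subseteq> closure U \<and>
             (\<forall>x\<in>U. differentials_independent \<sigma> R F S x)))"

end

(* Along the submanifold, e^(-beta theta) and the factors of f are inverted, resp. preserved, by
   sigma and the total rapidity factor is 1. Hence I |-> complement of sigma(I) preserves every
   summand of the h's, which gives K_{-l} = K_l = H_l there, and the restricted bracket of H_k and
   H_l is a multiple of {h_k, h_l} + {h_{n+1-k}, h_l} for the bracket of the full phase space.

   Grouping the double sum of {h_k, h_l} by the intersection and the symmetric difference E of the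
   two index sets reduces its vanishing to
     SUM over B in E, |B| = p, of (SUM over b in B of d/dq_b) PROD over b in B, c in E - B of f(q_b - q_c) = 0.
   This is the derivative at w = 1 of an identity between rational functions of z_j = e^(nu q_j),
   Ruijsenaars' functional equation for commuting difference operators with shift w. For w near 1,
   w /= 1, that identity has only simple poles in each variable: those at z_i = z_j cancel in pairs,
   those at z_i = w z_j and the value at infinity vanish by induction on |E|, and Liouville's
   theorem concludes.

   For independence let e^(-beta theta_i) grow like e^(s d_i) with distinct positive weights d_i on
   the representatives. As s goes to infinity each h_l is dominated by a single summand, which makes
   the rescaled matrix of the derivatives dH_l/dP_i triangular with nonzero diagonal. As its
   determinant is entire in s, it does not vanish for arbitrarily small s. *)

theory Submission
  imports Defs "HOL-Complex_Analysis.Complex_Analysis" "Jordan_Normal_Form.Determinant"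
begin

text \<open>At w = 1 itself the argument by poles breaks down: \<open>f\<close> has double poles and
  its derivative triple ones, so that the limit of (z - s) F(z) does not decide removability. Moving
  w off 1 separates them into simple poles. The induction mixes Ruijsenaars' equations for several
  p, where B has weight [|B| = p] - [|B| = |E| - p]. It is therefore run for all weights v(|B|) with
  v(k) + v(|E| - k) = 0 at once. This class is closed under what the induction produces: v(k) + v(k
  + 1) on one point fewer at infinity, and v(k + 1) on two points fewer at a shifted pole. The pair
  of fixed indices needs separate care. Its factor of \<open>f\<close> is the constant cosh^2 gamma,
  which may vanish or lie on the cut of the root. Hence the functional equation takes logarithmic
  derivatives in product form, derivative = value * factor, which survives a zero at which the
  derivative vanishes too, and for holomorphy the root of this factor is treated as a constant. For
  independence the derivatives in the rapidities suffice, which involve the roots only as constant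
  coefficients.\<close>

no_notation Matrix.vec_index (infixl \<open>$\<close> 100)
no_notation fps_nth (infixl \<open>$\<close> 75)

section \<open>Removable singularities and Liouville's theorem\<close>

lemma holomorphic_zero_if_removable:
  assumes "finite S" "F holomorphic_on (- S)"
    and "\<And>s. s \<in> S \<Longrightarrow> ((\<lambda>z. (z - s) * F z) \<longlongrightarrow> 0) (at s)"
    and "(F \<longlongrightarrow> 0) at_infinity" "z \<notin> S"
  shows "F z = 0"
  using assms
proof (induction S arbitrary: F rule: finite_induct)
  case empty
  then show ?case using Liouville_weak_0[of F z] by simp
next
  case (insert s S)
  have op: "open (- S)"
    using insert.hyps(1) by (simp add: finite_imp_closed open_Compl)
  have int: "s \<in> interior (- S)"
    using op insert.hyps(2) by (simp add: interior_open)
  have eq: "- S - {s} = - insert s S" by auto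
  have "\<exists>g. g holomorphic_on (- S) \<and> (\<forall>z\<in>- S - {s}. g z = F z)"
    using holomorphic_on_extend_lim[of F "- S" s] insert.prems(1,2) int unfolding eq by simp
  then obtain g where g: "g holomorphic_on (- S)" "\<And>z. z \<notin> insert s S \<Longrightarrow> g z = F z"
    by auto
  \<comment> \<open>Values of \<open>F\<close> on \<open>insert s S\<close> are arbitrary, so
    \<open>g\<close> and \<open>F\<close> are compared on punctured neighbourhoods only; this is
    enough to carry over the limits at the remaining points.\<close>
  have ev: "\<forall>\<^sub>F z in at t. g z = F z" for t
  proof -
    have "open (- (insert s S - {t}))"
      by (intro open_Compl finite_imp_closed) (use insert.hyps(1) in simp)
    then have "\<forall>\<^sub>F z in at t. z \<in> - (insert s S - {t}) - {t}"
      by (rule eventually_at_in_open) simp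
    then show ?thesis
      by eventually_elim (use g(2) in auto)
  qed
  have lim: "((\<lambda>z. (z - t) * g z) \<longlongrightarrow> 0) (at t)" if "t \<in> S" for t
    using insert.prems(2)[of t] that
    by (subst filterlim_cong[OF refl refl, of _ "\<lambda>z. (z - t) * F z"])
       (use ev[of t] in \<open>auto elim: eventually_mono\<close>)
  obtain b where b: "\<And>z. z \<in> insert s S \<Longrightarrow> norm z \<le> b"
    using finite_imp_bounded[of "insert s S"] insert.hyps(1) unfolding bounded_iff by blast
  have "\<forall>\<^sub>F z in at_infinity. g z = F z"
    unfolding eventually_at_infinity
  proof (intro exI[of _ "b + 1"] allI impI)
    fix z :: complex assume "b + 1 \<le> norm z"
    then have "z \<notin> insert s S" using b[of z] by auto
    then show "g z = F z" by (rule g(2))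
  qed
  then have inf: "(g \<longlongrightarrow> 0) at_infinity"
    using insert.prems(3) by (simp add: filterlim_cong)
  have "g z = 0"
    by (rule insert.IH[OF g(1) lim inf]) (use insert.prems(4) in auto)
  then show ?case using g(2) insert.prems(4) by simp
qed

lemma sum_Pow_insert:
  fixes g :: "'a set \<Rightarrow> 'b::comm_monoid_add"
  assumes "finite A" "x \<notin> A"
  shows "(\<Sum>B\<in>Pow (insert x A). g B) = (\<Sum>B\<in>Pow A. g B + g (insert x B))"
proof -
  have "(\<Sum>B\<in>Pow (insert x A). g B) = (\<Sum>B\<in>Pow A. g B) + (\<Sum>B\<in>insert x ` Pow A. g B)"
    unfolding Pow_insert by (rule sum.union_disjoint) (use assms in auto)
  also have "(\<Sum>B\<in>insert x ` Pow A. g B) = (\<Sum>B\<in>Pow A. g (insert x B))"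
    by (subst sum.reindex) (use assms in \<open>auto intro!: inj_onI\<close>)
  finally show ?thesis by (simp add: sum.distrib)
qed

section \<open>The functional equation\<close>

text \<open>With \<open>w = a b\<close> close to 1 this is a deformation of \<open>f\<close>, \<open>a = exp (2 \<gamma>)\<close>, splitting its double pole
  at \<open>u = v\<close> into the simple poles \<open>u = v\<close> and \<open>u = w v\<close>.\<close>

definition ratio :: "complex \<Rightarrow> complex \<Rightarrow> complex \<Rightarrow> complex \<Rightarrow> complex" where
  "ratio a b u v = ((u - a * v) * (u - b * v)) / ((u - v) * (u - a * b * v))"

definition cross :: "('a \<Rightarrow> 'a \<Rightarrow> complex) \<Rightarrow> 'a set \<Rightarrow> 'a set \<Rightarrow> complex" where
  "cross f B C = (\<Prod>b\<in>B. \<Prod>c\<in>C. f b c)"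

lemma cross_insert_right:
  assumes "finite C" "z \<notin> C"
  shows "cross f B (insert z C) = (\<Prod>b\<in>B. f b z) * cross f B C"
  using assms by (simp add: cross_def prod.distrib)

lemma cross_insert_left:
  assumes "finite B" "z \<notin> B"
  shows "cross f (insert z B) C = (\<Prod>c\<in>C. f z c) * cross f B C"
  using assms by (simp add: cross_def)

text \<open>Passing from (u, v) to (w v, u) with w = a b permutes the linear factors up to the
  scalar w. For w = 1 it is the evenness of \<open>f\<close>; at a shifted pole it makes the factors
  of two different points fuse into one product over all remaining points.\<close>

lemma ratio_reflect:
  assumes "a \<noteq> 0" "b \<noteq> 0"
  shows "ratio a b (a * b * v) u = ratio a b u v"
proof -
  have "ratio a b (a * b * v) u
      = ((a * b) * ((b * v - u) * (a * v - u))) / ((a * b) * ((a * b * v - u) * (v - u)))"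
    by (simp add: ratio_def algebra_simps)
  also have "\<dots> = ratio a b u v"
    using assms by (simp add: ratio_def) (simp add: algebra_simps)
  finally show ?thesis .
qed

section \<open>Limits and residues of the deformed ratio in either argument\<close>

lemma ratio_tendsto_infinity_left: "((\<lambda>z. ratio a b z v) \<longlongrightarrow> 1) at_infinity"
proof -
  have i: "((\<lambda>z::complex. 1 / z) \<longlongrightarrow> 0) at_infinity"
    using tendsto_inverse_0[where 'a = complex] by (simp add: inverse_eq_divide[abs_def])
  have "((\<lambda>z. ((1 - a * v * (1/z)) * (1 - b * v * (1/z))) / ((1 - v * (1/z)) * (1 - a * b * v * (1/z)))) \<longlongrightarrow>
     ((1 - a * v * 0) * (1 - b * v * 0)) / ((1 - v * 0) * (1 - a * b * v * 0))) at_infinity"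
    by (intro tendsto_intros i) auto
  moreover have "\<forall>\<^sub>F z in at_infinity. ((1 - a * v * (1/z)) * (1 - b * v * (1/z))) / ((1 - v * (1/z)) * (1 - a * b * v * (1/z))) = ratio a b z v"
    unfolding eventually_at_infinity
  proof (intro exI[of _ 1] allI impI)
    fix z :: complex assume "1 \<le> norm z"
    then have "z \<noteq> 0" by auto
    then have e: "1 - c * (1/z) = (z - c) / z" for c by (simp add: field_simps)
    show "((1 - a * v * (1/z)) * (1 - b * v * (1/z))) / ((1 - v * (1/z)) * (1 - a * b * v * (1/z))) = ratio a b z v"
      unfolding e ratio_def using \<open>z \<noteq> 0\<close> by simp
  qed
  ultimately show ?thesis
    by (simp add: filterlim_cong)
qed

text \<open>Exchanging the arguments amounts to inverting both parameters, which reduces this to the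
  limit in the left argument.\<close>

lemma ratio_tendsto_infinity_right:
  assumes "a \<noteq> 0" "b \<noteq> 0"
  shows "((\<lambda>z. ratio a b u z) \<longlongrightarrow> 1) at_infinity"
proof -
  have e: "ratio a b u z = ratio (1/a) (1/b) z u" for z
  proof -
    have "ratio (1/a) (1/b) z u = ((a*b) * ((z - u/a) * (z - u/b))) / ((a*b)*((z - u) * (z - u/(a*b))))"
      using assms by (simp add: ratio_def)
    also have "(a*b) * ((z - u/a) * (z - u/b)) = (u - a * z) * (u - b * z)"
      using assms by (simp add: field_simps)
    also have "(a*b)*((z - u) * (z - u/(a*b))) = (u - z) * (u - a * b * z)"
      using assms by (simp add: field_simps)
    finally show ?thesis by (simp add: ratio_def)
  qed
  show ?thesis unfolding e by (rule ratio_tendsto_infinity_left)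
qed

lemma ratio_tendsto_left:
  assumes "s \<noteq> v" "s \<noteq> a * b * v"
  shows "((\<lambda>z. ratio a b z v) \<longlongrightarrow> ratio a b s v) (at s)"
  unfolding ratio_def using assms by (intro tendsto_intros) auto

lemma ratio_tendsto_right:
  assumes "u \<noteq> s" "u \<noteq> a * b * s"
  shows "((\<lambda>z. ratio a b u z) \<longlongrightarrow> ratio a b u s) (at s)"
  unfolding ratio_def using assms by (intro tendsto_intros) auto

text \<open>The residues in the two arguments are opposite; this is the source of the cancellation
  in pairs at z_i = z_j.\<close>

lemma ratio_residue_diagonal:
  assumes "a * b \<noteq> 1" "v \<noteq> 0"
  shows "((\<lambda>z. (z - v) * ratio a b z v) \<longlongrightarrow> v * (1 - a) * (1 - b) / (1 - a * b)) (at v)"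
    and "((\<lambda>z. (z - v) * ratio a b v z) \<longlongrightarrow> - (v * (1 - a) * (1 - b) / (1 - a * b))) (at v)"
proof -
  have nz: "v - a * b * v \<noteq> 0" using assms by (simp add: algebra_simps)
  have ne: "\<forall>\<^sub>F z in at v. z \<noteq> v" by (simp add: eventually_at_filter)
  have val: "((v - a * v) * (v - b * v)) / (v - a * b * v) = v * (1 - a) * (1 - b) / (1 - a * b)"
  proof -
    have "((v - a * v) * (v - b * v)) / (v - a * b * v) = (v * (v * (1 - a) * (1 - b))) / (v * (1 - a * b))"
      by (simp add: algebra_simps)
    then show ?thesis using assms(2) by simp
  qed
  have "((\<lambda>z. ((z - a * v) * (z - b * v)) / (z - a * b * v)) \<longlongrightarrow>
      ((v - a * v) * (v - b * v)) / (v - a * b * v)) (at v)"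
    using nz by (intro tendsto_intros) auto
  moreover have "\<forall>\<^sub>F z in at v. ((z - a * v) * (z - b * v)) / (z - a * b * v) = (z - v) * ratio a b z v"
    using ne by eventually_elim (simp add: ratio_def)
  ultimately show "((\<lambda>z. (z - v) * ratio a b z v) \<longlongrightarrow> v * (1 - a) * (1 - b) / (1 - a * b)) (at v)"
    unfolding val by (simp add: filterlim_cong)
  have "((\<lambda>z. - (((v - a * z) * (v - b * z)) / (v - a * b * z))) \<longlongrightarrow>
      - (((v - a * v) * (v - b * v)) / (v - a * b * v))) (at v)"
    using nz by (intro tendsto_intros) auto
  moreover have "\<forall>\<^sub>F z in at v. - (((v - a * z) * (v - b * z)) / (v - a * b * z)) = (z - v) * ratio a b v z"
    using ne
  proof eventually_elim
    case (elim z)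
    have "t * (N / (- t * D)) = - (N / D)" if "t \<noteq> 0" for t N D :: complex
      using that by simp
    from this[of "z - v" "(v - a * z) * (v - b * z)" "v - a * b * z"] show ?case
      using elim by (simp add: ratio_def)
  qed
  ultimately show "((\<lambda>z. (z - v) * ratio a b v z) \<longlongrightarrow> - (v * (1 - a) * (1 - b) / (1 - a * b))) (at v)"
    unfolding val by (simp add: filterlim_cong)
qed

text \<open>Only the order of the pole matters: the residue will be multiplied by a sum that
  vanishes by induction, so its value is left open.\<close>

lemma ratio_residue_shifted:
  assumes "a * b \<noteq> 1" "a * b \<noteq> 0" "v \<noteq> 0"
  shows "\<exists>r. ((\<lambda>z. (z - a * b * v) * ratio a b z v) \<longlongrightarrow> r) (at (a * b * v))"
    and "\<exists>r. ((\<lambda>z. (z - v / (a * b)) * ratio a b v z) \<longlongrightarrow> r) (at (v / (a * b)))"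
proof -
  have nz: "a * b * v - v \<noteq> 0" using assms by (simp add: algebra_simps)
  have ne: "\<forall>\<^sub>F z in at s. z \<noteq> s" for s :: complex by (simp add: eventually_at_filter)
  have "((\<lambda>z. ((z - a * v) * (z - b * v)) / (z - v)) \<longlongrightarrow>
      ((a * b * v - a * v) * (a * b * v - b * v)) / (a * b * v - v)) (at (a * b * v))"
    using nz by (intro tendsto_intros) auto
  moreover have "\<forall>\<^sub>F z in at (a * b * v). ((z - a * v) * (z - b * v)) / (z - v) = (z - a * b * v) * ratio a b z v"
    using ne by eventually_elim (simp add: ratio_def)
  ultimately show "\<exists>r. ((\<lambda>z. (z - a * b * v) * ratio a b z v) \<longlongrightarrow> r) (at (a * b * v))"
    by (auto simp: filterlim_cong)
  let ?s = "v / (a * b)"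
  have nz': "v - ?s \<noteq> 0" using assms by (simp add: field_simps)
  have "((\<lambda>z. - (((v - a * z) * (v - b * z)) / ((v - z) * (a * b)))) \<longlongrightarrow>
      - (((v - a * ?s) * (v - b * ?s)) / ((v - ?s) * (a * b)))) (at ?s)"
    by (intro tendsto_intros) (use nz' assms in auto)
  moreover have "\<forall>\<^sub>F z in at ?s. - (((v - a * z) * (v - b * z)) / ((v - z) * (a * b))) = (z - ?s) * ratio a b v z"
    using ne
  proof eventually_elim
    case (elim z)
    have "v - a * b * z = - (z - ?s) * (a * b)"
      using assms(2) by (simp add: field_simps)
    moreover have "t * (N / (D * (- t * k))) = - (N / (D * k))" if "t \<noteq> 0" for t N D k :: complex
      using that by simp
    ultimately show ?case using elim by (metis ratio_def right_minus_eq)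
  qed
  ultimately show "\<exists>r. ((\<lambda>z. (z - v / (a * b)) * ratio a b v z) \<longlongrightarrow> r) (at (v / (a * b)))"
    by (auto simp: filterlim_cong)
qed

text \<open>One point is made variable, and the resulting function of it is shown to have removable
  singularities only and to vanish at infinity. Excluding \<open>s = a * b * t\<close> keeps the sum
  finite, while excluding \<open>s = (a * b)\<^sup>2 * t\<close> keeps the shifted poles that belong
  to different points apart.\<close>

theorem ratio_sum_eq_0:
  assumes "a * b \<noteq> 0" "(a * b)\<^sup>2 \<noteq> 1"
    and "finite E" "0 \<notin> E"
    and "\<And>s t. s \<in> E \<Longrightarrow> t \<in> E \<Longrightarrow> s \<noteq> t \<Longrightarrow> s \<noteq> a * b * t \<and> s \<noteq> (a * b)\<^sup>2 * t"
    and "\<And>k. k \<le> card E \<Longrightarrow> v k + v (card E - k) = 0"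
  shows "(\<Sum>B\<in>Pow E. v (card B) * cross (ratio a b) B (E - B)) = 0"
  using assms(3-)
proof (induction "card E" arbitrary: E v rule: less_induct)
  case less
  note fin = less.prems(1) and E0 = less.prems(2) and gen = less.prems(3) and anti = less.prems(4)
  define w where "w = a * b"
  let ?r = "ratio a b"
  have w: "w \<noteq> 0" "w \<noteq> 1" "w\<^sup>2 \<noteq> 1" "a \<noteq> 0" "b \<noteq> 0"
    using assms(1,2) by (auto simp: w_def)
  show ?case
  proof (cases "E = {}")
    case True
    then show ?thesis using anti[of 0] by simp
  next
    case False
    then obtain x E0 where x: "x \<notin> E0" "E = insert x E0"
      by (meson mk_disjoint_insert ex_in_conv)
    have finE0: "finite E0" using fin x by simp
    have card: "card E = Suc (card E0)" using x finE0 by simp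
    \<comment> \<open>The sum as a function of the point \<open>x\<close>. The two terms in the
      bracket collect the subsets that omit the variable point and those that contain it.\<close>
    define F where "F z = (\<Sum>B\<in>Pow E0. cross ?r B (E0 - B) *
      (v (card B) * (\<Prod>b\<in>B. ?r b z) + v (Suc (card B)) * (\<Prod>c\<in>E0 - B. ?r z c)))" for z
    have split: "(\<Sum>B\<in>Pow E. v (card B) * cross ?r B (E - B)) = F x"
      unfolding x(2) sum_Pow_insert[OF finE0 x(1)] F_def
    proof (rule sum.cong[OF refl])
      fix B assume "B \<in> Pow E0"
      then have B: "B \<subseteq> E0" "finite B" "x \<notin> B" "x \<notin> E0 - B"
        using finE0 x finite_subset by auto
      have "insert x E0 - B = insert x (E0 - B)" "insert x E0 - insert x B = E0 - B"
        using B x by auto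
      then show "v (card B) * cross ?r B (insert x E0 - B) +
          v (card (insert x B)) * cross ?r (insert x B) (insert x E0 - insert x B) =
        cross ?r B (E0 - B) * (v (card B) * (\<Prod>b\<in>B. ?r b x) + v (Suc (card B)) * (\<Prod>c\<in>E0 - B. ?r x c))"
        using B finE0 by (simp add: cross_insert_left cross_insert_right algebra_simps)
    qed
    \<comment> \<open>All candidates for poles: the diagonal, then z = w e from ratios with z on the
      left, and z = e / w from those with z on the right.\<close>
    define S where "S = E0 \<union> (\<lambda>e. w * e) ` E0 \<union> (\<lambda>e. e / w) ` E0"
    have gen0: "s \<noteq> w * t" "s \<noteq> w\<^sup>2 * t" if "s \<in> E0" "t \<in> E0" "s \<noteq> t" for s t
      using gen[of s t] that x by (auto simp: w_def)
    have "x \<noteq> e" "x \<noteq> w * e" "e \<noteq> w * x" if "e \<in> E0" for e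
    proof -
      have "x \<noteq> e" "e \<noteq> x" "x \<in> E" "e \<in> E" using x that by auto
      then show "x \<noteq> e" "x \<noteq> w * e" "e \<noteq> w * x"
        using gen[of x e] gen[of e x] unfolding w_def by blast+
    qed
    then have xS: "x \<notin> S"
      using w(1) by (fastforce simp: S_def)
    have "F x = 0"
    proof (rule holomorphic_zero_if_removable[of S F])
      show "finite S" using finE0 by (simp add: S_def)
      show "x \<notin> S" by (rule xS)
      show "F holomorphic_on - S"
      proof -
        have "(\<lambda>z. ?r z c) holomorphic_on - S" "(\<lambda>z. ?r c z) holomorphic_on - S" if "c \<in> E0" for c
        proof -
          have "z - c \<noteq> 0" "c - z \<noteq> 0" "z - a * b * c \<noteq> 0" "c - a * b * z \<noteq> 0" if "z \<in> - S" for z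
          proof -
            have z: "z \<noteq> c" "z \<noteq> w * c" "z \<noteq> c / w"
              using that \<open>c \<in> E0\<close> by (auto simp: S_def)
            then have "c \<noteq> w * z" using w(1) by auto
            with z show "z - c \<noteq> 0" "c - z \<noteq> 0" "z - a * b * c \<noteq> 0" "c - a * b * z \<noteq> 0"
              by (auto simp: w_def)
          qed
          then show "(\<lambda>z. ?r z c) holomorphic_on - S" "(\<lambda>z. ?r c z) holomorphic_on - S"
            unfolding ratio_def by (auto intro!: holomorphic_intros)
        qed
        then show ?thesis
          unfolding F_def by (intro holomorphic_intros) auto
      qed
      \<comment> \<open>Every ratio that involves z tends to 1, so the subsets with and without z
        that have the same trace on \<open>E0\<close> merge. The new weight v k + v (k + 1) inherits
        its antisymmetry from that of v at k and at k + 1.\<close>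
      have "(F \<longlongrightarrow> (\<Sum>B\<in>Pow E0. cross ?r B (E0 - B) *
          (v (card B) * (\<Prod>b\<in>B. 1) + v (Suc (card B)) * (\<Prod>c\<in>E0 - B. 1)))) at_infinity"
        unfolding F_def
        by (intro tendsto_intros ratio_tendsto_infinity_left ratio_tendsto_infinity_right w)
      also have "(\<Sum>B\<in>Pow E0. cross ?r B (E0 - B) *
          (v (card B) * (\<Prod>b\<in>B. 1) + v (Suc (card B)) * (\<Prod>c\<in>E0 - B. 1)))
          = (\<Sum>B\<in>Pow E0. (v (card B) + v (Suc (card B))) * cross ?r B (E0 - B))"
        by (intro sum.cong refl) (simp add: mult.commute)
      also have "\<dots> = 0"
      proof (rule less.hyps[where v = "\<lambda>k. v k + v (Suc k)"])
        fix k assume "k \<le> card E0"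
        then have 1: "v k + v (Suc (card E0 - k)) = 0" "v (Suc k) + v (card E0 - k) = 0"
          using anti[of k] anti[of "Suc k"] by (simp_all add: card Suc_diff_le)
        have "v k + v (Suc k) + (v (card E0 - k) + v (Suc (card E0 - k))) =
            (v k + v (Suc (card E0 - k))) + (v (Suc k) + v (card E0 - k))"
          by (simp add: algebra_simps)
        then show "v k + v (Suc k) + (v (card E0 - k) + v (Suc (card E0 - k))) = 0"
          unfolding 1 by simp
      qed (use card finE0 E0 gen x in auto)
      finally show "(F \<longlongrightarrow> 0) at_infinity" .
    next
      fix s assume "s \<in> S"
      then obtain e where e: "e \<in> E0" "s = e \<or> s = w * e \<or> s = e / w"
        by (auto simp: S_def)
      define E1 where "E1 = E0 - {e}"
      have E1: "e \<notin> E1" "finite E1" "E0 = insert e E1" "E1 \<subseteq> E0" "card E = Suc (Suc (card E1))"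
        using e(1) finE0 card card_Suc_Diff1[of E0 e] by (auto simp: E1_def)
      have enz: "e \<noteq> 0" using e(1) E0 x by auto
      \<comment> \<open>Here w^2 \<noteq> 1 enters: otherwise w e and e / w would coincide.\<close>
      have reg: "e \<noteq> w * e" "e \<noteq> w\<^sup>2 * e" "e \<noteq> e / w" "e / w \<noteq> w * e"
        using w enz by (auto simp: field_simps power2_eq_square)
      have regs: "s \<noteq> c" "s \<noteq> w * c" "c \<noteq> w * s" if "c \<in> E1" for c
      proof -
        have "c \<in> E0" "c \<noteq> e" "e \<noteq> c" using that E1 by auto
        then have "c \<noteq> e" "e \<noteq> w * c" "c \<noteq> w * e" "e \<noteq> w\<^sup>2 * c" "c \<noteq> w\<^sup>2 * e"
          using gen0[of c e] gen0[of e c] e(1) by auto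
        then show "s \<noteq> c" "s \<noteq> w * c" "c \<noteq> w * s"
          using e(2) w(1) by (auto simp: field_simps power2_eq_square)
      qed
      have rz: "((\<lambda>z. ?r z c) \<longlongrightarrow> ?r s c) (at s)" "((\<lambda>z. ?r c z) \<longlongrightarrow> ?r c s) (at s)" if "c \<in> E1" for c
        using regs[OF that] by (auto intro!: ratio_tendsto_left ratio_tendsto_right simp: w_def)
      \<comment> \<open>Near a pole only subsets separating e from z matter. They contain exactly
        one of the two points, hence the shift by one in v; with two points removed the shifted
        weight is antisymmetric again.\<close>
      have IH: "(\<Sum>B\<in>Pow E1. v (Suc (card B)) * cross ?r B (E1 - B)) = 0"
      proof (rule less.hyps[where v = "\<lambda>k. v (Suc k)"])
        fix k assume "k \<le> card E1"
        then show "v (Suc k) + v (Suc (card E1 - k)) = 0"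
          using anti[of "Suc k"] by (simp add: E1(5) Suc_diff_le)
      qed (use E1 E0 gen x in auto)
      \<comment> \<open>Splitting once more, by membership of e, gives four terms. The ratio between
        z and e, the only factor singular at s, occurs in the two terms where exactly one of them is
        chosen.\<close>
      have Feq: "F z = (\<Sum>B\<in>Pow E1. cross ?r B (E1 - B) *
          ((\<Prod>b\<in>B. ?r b e) * (v (card B) * (\<Prod>b\<in>B. ?r b z)
              + v (Suc (card B)) * (?r z e * (\<Prod>c\<in>E1 - B. ?r z c)))
          + (\<Prod>c\<in>E1 - B. ?r e c) * (v (Suc (card B)) * (?r e z * (\<Prod>b\<in>B. ?r b z))
              + v (Suc (Suc (card B))) * (\<Prod>c\<in>E1 - B. ?r z c))))" for z
        unfolding F_def E1(3) sum_Pow_insert[OF E1(2,1)]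
      proof (rule sum.cong[OF refl])
        fix B assume "B \<in> Pow E1"
        then have B: "B \<subseteq> E1" "finite B" "e \<notin> B" "e \<notin> E1 - B" "finite (E1 - B)"
          using E1 finite_subset by auto
        have d: "insert e E1 - B = insert e (E1 - B)" "insert e E1 - insert e B = E1 - B"
          using B E1 by auto
        show "cross ?r B (insert e E1 - B) *
            (v (card B) * (\<Prod>b\<in>B. ?r b z) + v (Suc (card B)) * (\<Prod>c\<in>insert e E1 - B. ?r z c)) +
          cross ?r (insert e B) (insert e E1 - insert e B) *
            (v (card (insert e B)) * (\<Prod>b\<in>insert e B. ?r b z)
              + v (Suc (card (insert e B))) * (\<Prod>c\<in>insert e E1 - insert e B. ?r z c)) =
          cross ?r B (E1 - B) *
          ((\<Prod>b\<in>B. ?r b e) * (v (card B) * (\<Prod>b\<in>B. ?r b z)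
              + v (Suc (card B)) * (?r z e * (\<Prod>c\<in>E1 - B. ?r z c)))
          + (\<Prod>c\<in>E1 - B. ?r e c) * (v (Suc (card B)) * (?r e z * (\<Prod>b\<in>B. ?r b z))
              + v (Suc (Suc (card B))) * (\<Prod>c\<in>E1 - B. ?r z c)))"
          unfolding d cross_insert_left[OF B(2,3)] cross_insert_right[OF B(5,4)]
            prod.insert[OF B(2,3)] prod.insert[OF B(5,4)] card_insert_disjoint[OF B(2,3)]
          by (simp add: algebra_simps)
      qed
      have zs: "((\<lambda>z. z - s) \<longlongrightarrow> 0) (at s)"
        by (simp add: LIM_zero_iff)
      \<comment> \<open>\<open>\<rho>1\<close> and \<open>\<rho>2\<close> are the residues with z on
        the left and on the right of e; a ratio that is regular at s gets residue 0.\<close>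
      have lim: "((\<lambda>z. (z - s) * F z) \<longlongrightarrow> (\<Sum>B\<in>Pow E1. v (Suc (card B)) * cross ?r B (E1 - B) *
          (\<rho>1 * ((\<Prod>b\<in>B. ?r b e) * (\<Prod>c\<in>E1 - B. ?r s c))
          + \<rho>2 * ((\<Prod>c\<in>E1 - B. ?r e c) * (\<Prod>b\<in>B. ?r b s))))) (at s)"
        if \<rho>: "((\<lambda>z. (z - s) * ?r z e) \<longlongrightarrow> \<rho>1) (at s)" "((\<lambda>z. (z - s) * ?r e z) \<longlongrightarrow> \<rho>2) (at s)"
        for \<rho>1 \<rho>2
      proof -
        have "((\<lambda>z. \<Sum>B\<in>Pow E1. cross ?r B (E1 - B) *
          ((\<Prod>b\<in>B. ?r b e) * (v (card B) * ((z - s) * (\<Prod>b\<in>B. ?r b z))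
              + v (Suc (card B)) * (((z - s) * ?r z e) * (\<Prod>c\<in>E1 - B. ?r z c)))
          + (\<Prod>c\<in>E1 - B. ?r e c) * (v (Suc (card B)) * (((z - s) * ?r e z) * (\<Prod>b\<in>B. ?r b z))
              + v (Suc (Suc (card B))) * ((z - s) * (\<Prod>c\<in>E1 - B. ?r z c))))) \<longlongrightarrow>
          (\<Sum>B\<in>Pow E1. cross ?r B (E1 - B) *
          ((\<Prod>b\<in>B. ?r b e) * (v (card B) * (0 * (\<Prod>b\<in>B. ?r b s))
              + v (Suc (card B)) * (\<rho>1 * (\<Prod>c\<in>E1 - B. ?r s c)))
          + (\<Prod>c\<in>E1 - B. ?r e c) * (v (Suc (card B)) * (\<rho>2 * (\<Prod>b\<in>B. ?r b s))
              + v (Suc (Suc (card B))) * (0 * (\<Prod>c\<in>E1 - B. ?r s c)))))) (at s)"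
          by (intro tendsto_intros zs rz \<rho>) auto
        moreover have "(\<lambda>z. \<Sum>B\<in>Pow E1. cross ?r B (E1 - B) *
          ((\<Prod>b\<in>B. ?r b e) * (v (card B) * ((z - s) * (\<Prod>b\<in>B. ?r b z))
              + v (Suc (card B)) * (((z - s) * ?r z e) * (\<Prod>c\<in>E1 - B. ?r z c)))
          + (\<Prod>c\<in>E1 - B. ?r e c) * (v (Suc (card B)) * (((z - s) * ?r e z) * (\<Prod>b\<in>B. ?r b z))
              + v (Suc (Suc (card B))) * ((z - s) * (\<Prod>c\<in>E1 - B. ?r z c))))) = (\<lambda>z. (z - s) * F z)"
          unfolding Feq sum_distrib_left
          by (intro ext sum.cong refl) (simp add: algebra_simps)
        moreover have "(\<Sum>B\<in>Pow E1. cross ?r B (E1 - B) *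
          ((\<Prod>b\<in>B. ?r b e) * (v (card B) * (0 * (\<Prod>b\<in>B. ?r b s))
              + v (Suc (card B)) * (\<rho>1 * (\<Prod>c\<in>E1 - B. ?r s c)))
          + (\<Prod>c\<in>E1 - B. ?r e c) * (v (Suc (card B)) * (\<rho>2 * (\<Prod>b\<in>B. ?r b s))
              + v (Suc (Suc (card B))) * (0 * (\<Prod>c\<in>E1 - B. ?r s c))))) =
          (\<Sum>B\<in>Pow E1. v (Suc (card B)) * cross ?r B (E1 - B) *
          (\<rho>1 * ((\<Prod>b\<in>B. ?r b e) * (\<Prod>c\<in>E1 - B. ?r s c))
          + \<rho>2 * ((\<Prod>c\<in>E1 - B. ?r e c) * (\<Prod>b\<in>B. ?r b s))))"
          by (intro sum.cong refl) (simp add: algebra_simps)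
        ultimately show ?thesis by simp
      qed
      have regular: "((\<lambda>z. (z - s) * g z) \<longlongrightarrow> 0) (at s)" if "(g \<longlongrightarrow> l) (at s)" for g l
        using tendsto_mult[OF zs that] by simp
      have prodE1: "(\<Prod>b\<in>B. h b) * (\<Prod>c\<in>E1 - B. h c) = (\<Prod>c\<in>E1. h c)" if "B \<in> Pow E1" for B and h :: "complex \<Rightarrow> complex"
        using prod.subset_diff[of B E1 h] that E1(2) by (simp add: mult.commute)
      have factor: "(\<Sum>B\<in>Pow E1. v (Suc (card B)) * cross ?r B (E1 - B) * m) = 0" for m
        using IH by (simp flip: sum_distrib_right)
      have refl_e: "?r u e = ?r (w * e) u" for u
        using ratio_reflect[of a b e u] w by (simp add: w_def)
      consider "s = e" | "s = w * e" | "s = e / w" using e(2) by blast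
      then show "((\<lambda>z. (z - s) * F z) \<longlongrightarrow> 0) (at s)"
      proof cases
        \<comment> \<open>At z = e the two points are interchangeable, so the cofactors of the two
          opposite residues agree summand by summand.\<close>
        case 1
        let ?\<rho> = "e * (1 - a) * (1 - b) / (1 - a * b)"
        have "((\<lambda>z. (z - s) * F z) \<longlongrightarrow> (\<Sum>B\<in>Pow E1. v (Suc (card B)) * cross ?r B (E1 - B) *
          (?\<rho> * ((\<Prod>b\<in>B. ?r b e) * (\<Prod>c\<in>E1 - B. ?r s c))
          + - ?\<rho> * ((\<Prod>c\<in>E1 - B. ?r e c) * (\<Prod>b\<in>B. ?r b s))))) (at s)"
          by (rule lim; unfold 1; rule ratio_residue_diagonal) (use w enz in \<open>auto simp: w_def\<close>)
        also have "(\<Sum>B\<in>Pow E1. v (Suc (card B)) * cross ?r B (E1 - B) *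
          (?\<rho> * ((\<Prod>b\<in>B. ?r b e) * (\<Prod>c\<in>E1 - B. ?r s c))
          + - ?\<rho> * ((\<Prod>c\<in>E1 - B. ?r e c) * (\<Prod>b\<in>B. ?r b s)))) = 0"
          by (intro sum.neutral ballI) (simp add: 1 mult_ac)
        finally show ?thesis .
      next
        \<comment> \<open>Only the ratio with z on the left is singular. Since s = w e, reflection
          turns each \<open>?r b e\<close> into \<open>?r s b\<close>; the products over
          \<open>B\<close> and \<open>E1 - B\<close> then combine to a product over
          \<open>E1\<close> that does not depend on \<open>B\<close> and leaves the sum
          \<open>IH\<close>.\<close>
        case 2
        obtain \<rho> where \<rho>: "((\<lambda>z. (z - s) * ?r z e) \<longlongrightarrow> \<rho>) (at s)"
          using ratio_residue_shifted(1)[of a b e] w enz by (auto simp: 2 w_def)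
        have "((\<lambda>z. ?r e z) \<longlongrightarrow> ?r e s) (at s)"
          by (rule ratio_tendsto_right) (use reg in \<open>auto simp: 2 w_def power2_eq_square mult.assoc\<close>)
        from lim[OF \<rho> regular[OF this]]
        have "((\<lambda>z. (z - s) * F z) \<longlongrightarrow> (\<Sum>B\<in>Pow E1. v (Suc (card B)) * cross ?r B (E1 - B) *
          (\<rho> * ((\<Prod>b\<in>B. ?r b e) * (\<Prod>c\<in>E1 - B. ?r s c))))) (at s)"
          by simp
        also have "(\<Sum>B\<in>Pow E1. v (Suc (card B)) * cross ?r B (E1 - B) *
          (\<rho> * ((\<Prod>b\<in>B. ?r b e) * (\<Prod>c\<in>E1 - B. ?r s c)))) =
          (\<Sum>B\<in>Pow E1. v (Suc (card B)) * cross ?r B (E1 - B) * (\<rho> * (\<Prod>c\<in>E1. ?r s c)))"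
          by (intro sum.cong refl) (simp add: refl_e 2 prodE1)
        finally show ?thesis by (simp add: factor)
      next
        \<comment> \<open>The mirror image: now w s = e, and reflection turns \<open>?r b s\<close>
          into \<open>?r e b\<close>.\<close>
        case 3
        obtain \<rho> where \<rho>: "((\<lambda>z. (z - s) * ?r e z) \<longlongrightarrow> \<rho>) (at s)"
          using ratio_residue_shifted(2)[of a b e] w enz by (auto simp: 3 w_def)
        have "((\<lambda>z. ?r z e) \<longlongrightarrow> ?r s e) (at s)"
          by (rule ratio_tendsto_left) (use reg in \<open>auto simp: 3 w_def\<close>)
        from lim[OF regular[OF this] \<rho>]
        have "((\<lambda>z. (z - s) * F z) \<longlongrightarrow> (\<Sum>B\<in>Pow E1. v (Suc (card B)) * cross ?r B (E1 - B) *
          (\<rho> * ((\<Prod>c\<in>E1 - B. ?r e c) * (\<Prod>b\<in>B. ?r b s))))) (at s)"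
          by simp
        also have "(\<Sum>B\<in>Pow E1. v (Suc (card B)) * cross ?r B (E1 - B) *
          (\<rho> * ((\<Prod>c\<in>E1 - B. ?r e c) * (\<Prod>b\<in>B. ?r b s)))) =
          (\<Sum>B\<in>Pow E1. v (Suc (card B)) * cross ?r B (E1 - B) * (\<rho> * (\<Prod>c\<in>E1. ?r e c)))"
        proof (intro sum.cong refl)
          fix B assume B: "B \<in> Pow E1"
          have "?r u s = ?r e u" for u
            using ratio_reflect[of a b s u] w by (simp add: w_def 3)
          then show "v (Suc (card B)) * cross ?r B (E1 - B) *
            (\<rho> * ((\<Prod>c\<in>E1 - B. ?r e c) * (\<Prod>b\<in>B. ?r b s))) =
            v (Suc (card B)) * cross ?r B (E1 - B) * (\<rho> * (\<Prod>c\<in>E1. ?r e c))"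
            using prodE1[OF B, of "?r e"] by (simp add: mult.commute)
        qed
        finally show ?thesis by (simp add: factor)
      qed
    qed
    then show ?thesis using split by simp
  qed
qed

section \<open>Differentiating the functional equation at w = 1\<close>

text \<open>The derivative at \<open>w = 1\<close> of \<open>ratio a (w / a) u v\<close>.\<close>

definition ratio_deriv :: "complex \<Rightarrow> complex \<Rightarrow> complex \<Rightarrow> complex" where
  "ratio_deriv a u v = (1 - 1 / a) * (u - a * v) * u * v / (u - v) ^ 3"

lemma has_field_derivative_ratio:
  assumes "a \<noteq> 0" "u \<noteq> v"
  shows "((\<lambda>w. ratio a (w / a) u v) has_field_derivative ratio_deriv a u v) (at 1)"
proof -
  have e: "ratio a (w / a) u v = (u - a * v) / (u - v) * ((u - w / a * v) / (u - w * v))" for w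
    using assms by (simp add: ratio_def)
  have D: "((\<lambda>w. (u - w / a * v) / (u - w * v)) has_field_derivative
     ((- (1 / a * v)) * (u - 1 * v) - (u - 1 / a * v) * (- v)) / ((u - 1 * v) * (u - 1 * v))) (at 1)"
    by (rule derivative_eq_intros refl | use assms in simp)+
  have "(- (1 / a * v)) * (u - 1 * v) - (u - 1 / a * v) * (- v) = (1 - 1 / a) * u * v"
    by (simp add: algebra_simps diff_divide_distrib)
  with D have "((\<lambda>w. (u - w / a * v) / (u - w * v)) has_field_derivative
     ((1 - 1 / a) * u * v) / (u - v) ^ 2) (at 1)"
    by (simp add: power2_eq_square)
  from DERIV_cmult[OF this, of "(u - a * v) / (u - v)"] show ?thesis
    unfolding e ratio_deriv_def by (simp add: power3_eq_cube power2_eq_square mult_ac)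
qed

text \<open>The product form \<open>f x z * g x\<close> of the derivative avoids dividing by
  \<open>f x z\<close>, so factors may vanish as long as their derivative vanishes with
  them.\<close>

lemma has_field_derivative_prod_log:
  fixes f :: "'a \<Rightarrow> 'b::real_normed_field \<Rightarrow> 'b"
  assumes "finite A" "\<And>x. x \<in> A \<Longrightarrow> (f x has_field_derivative f x z * g x) (at z)"
  shows "((\<lambda>u. \<Prod>x\<in>A. f x u) has_field_derivative (\<Prod>x\<in>A. f x z) * (\<Sum>x\<in>A. g x)) (at z)"
proof -
  have "(\<Sum>x\<in>A. f x z * g x * (\<Prod>y\<in>A - {x}. f y z)) = (\<Prod>x\<in>A. f x z) * (\<Sum>x\<in>A. g x)"
    unfolding sum_distrib_left
    by (intro sum.cong refl) (simp add: prod.remove[OF assms(1)] mult_ac)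
  then show ?thesis
    using has_field_derivative_prod[of A f "\<lambda>x. f x z * g x" z] assms(2) by simp
qed

lemma cross_has_field_derivative:
  assumes "finite B" "finite C"
    and "\<And>b c. b \<in> B \<Longrightarrow> c \<in> C \<Longrightarrow> ((\<lambda>w. f w b c) has_field_derivative f z b c * g b c) (at z)"
  shows "((\<lambda>w. cross (f w) B C) has_field_derivative cross (f z) B C * (\<Sum>b\<in>B. \<Sum>c\<in>C. g b c)) (at z)"
  unfolding cross_def using assms by (intro has_field_derivative_prod_log) auto

lemma ratio_sum_eq_0_indexed:
  assumes "a * b \<noteq> 0" "(a * b)\<^sup>2 \<noteq> 1" "finite A" "inj_on x A" "0 \<notin> x ` A"
    and "\<And>i j. i \<in> A \<Longrightarrow> j \<in> A \<Longrightarrow> i \<noteq> j \<Longrightarrow> x i \<noteq> a * b * x j \<and> x i \<noteq> (a * b)\<^sup>2 * x j"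
    and "\<And>k. k \<le> card A \<Longrightarrow> v k + v (card A - k) = 0"
  shows "(\<Sum>B\<in>Pow A. v (card B) * cross (\<lambda>i j. ratio a b (x i) (x j)) B (A - B)) = 0"
proof -
  have inj: "inj_on x B" if "B \<subseteq> A" for B
    using assms(4) that by (rule inj_on_subset)
  have "(\<Sum>B\<in>Pow (x ` A). v (card B) * cross (ratio a b) B (x ` A - B)) = 0"
    using assms by (intro ratio_sum_eq_0) (auto simp: card_image)
  also have "Pow (x ` A) = (image x) ` Pow A"
    by (simp add: image_Pow_surj)
  also have "(\<Sum>B\<in>(image x) ` Pow A. v (card B) * cross (ratio a b) B (x ` A - B)) =
      (\<Sum>B\<in>Pow A. v (card B) * cross (\<lambda>i j. ratio a b (x i) (x j)) B (A - B))"
  proof (subst sum.reindex)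
    show "inj_on (image x) (Pow A)"
      using assms(4) by (rule inj_on_image_Pow)
    show "sum ((\<lambda>B. v (card B) * cross (ratio a b) B (x ` A - B)) \<circ> (image x)) (Pow A) =
      (\<Sum>B\<in>Pow A. v (card B) * cross (\<lambda>i j. ratio a b (x i) (x j)) B (A - B))"
    proof (intro sum.cong refl)
      fix B assume "B \<in> Pow A"
      then have B: "B \<subseteq> A" by simp
      have "x ` A - x ` B = x ` (A - B)"
        using inj_on_image_set_diff[OF assms(4), of A B] B by auto
      then show "((\<lambda>B. v (card B) * cross (ratio a b) B (x ` A - B)) \<circ> (image x)) B =
        v (card B) * cross (\<lambda>i j. ratio a b (x i) (x j)) B (A - B)"
        using inj[OF B] inj[of "A - B"] by (simp add: cross_def card_image prod.reindex)
    qed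
  qed
  finally show ?thesis by simp
qed

text \<open>With b = w / a the weighted sum is a function of w that vanishes for all w close to 1
  except possibly 1. It is differentiable at 1, so its value there vanishes by continuity and its
  derivative as well.\<close>

lemma functional_equation_weighted:
  assumes "a \<noteq> 0" "finite A" "inj_on x A" "0 \<notin> x ` A"
    and anti: "\<And>k. k \<le> card A \<Longrightarrow> v k + v (card A - k) = 0"
    and psi: "\<And>i j. i \<in> A \<Longrightarrow> j \<in> A \<Longrightarrow> i \<noteq> j \<Longrightarrow>
      ratio_deriv a (x i) (x j) = ratio a (1 / a) (x i) (x j) * \<psi> i j"
  shows "(\<Sum>B\<in>Pow A. v (card B) * (cross (\<lambda>i j. ratio a (1 / a) (x i) (x j)) B (A - B) *
           (\<Sum>b\<in>B. \<Sum>c\<in>A - B. \<psi> b c))) = 0"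
proof -
  define G where "G w = (\<Sum>B\<in>Pow A. v (card B) * cross (\<lambda>i j. ratio a (w / a) (x i) (x j)) B (A - B))" for w
  have "(G has_field_derivative (\<Sum>B\<in>Pow A. v (card B) * (cross (\<lambda>i j. ratio a (1 / a) (x i) (x j)) B (A - B) *
           (\<Sum>b\<in>B. \<Sum>c\<in>A - B. \<psi> b c)))) (at 1)"
    unfolding G_def
  proof (intro DERIV_sum DERIV_cmult cross_has_field_derivative)
    fix B b c assume "B \<in> Pow A" "b \<in> B" "c \<in> A - B"
    then have bc: "b \<in> A" "c \<in> A" "b \<noteq> c" "x b \<noteq> x c"
      using assms(3) by (auto dest: inj_onD)
    show "((\<lambda>w. ratio a (w / a) (x b) (x c)) has_field_derivative
        ratio a (1 / a) (x b) (x c) * \<psi> b c) (at 1)"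
      using has_field_derivative_ratio[OF assms(1) bc(4)] psi[OF bc(1-3)] by simp
  qed (use assms(2) finite_subset in auto)
  moreover have "(G has_field_derivative 0) (at 1)"
  proof -
    have ev: "\<forall>\<^sub>F w in at 1. w \<noteq> (c::complex)" for c
    proof (cases "c = 1")
      case False
      then show ?thesis by (intro tendsto_imp_eventually_ne[of _ 1] tendsto_ident_at) auto
    qed (simp add: eventually_at_filter)
    have ev2: "\<forall>\<^sub>F w in at 1. w\<^sup>2 \<noteq> (c::complex)" if "c \<noteq> 1" for c
      by (rule tendsto_imp_eventually_ne[of _ "1\<^sup>2"], rule tendsto_power, rule tendsto_ident_at)
         (use that in simp)
    \<comment> \<open>Distinct points have quotients different from 1, so the finitely many
      forbidden values of w and w^2 stay away from w = 1.\<close>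
    have "\<forall>\<^sub>F w in at 1. \<forall>p\<in>{p \<in> A \<times> A. fst p \<noteq> snd p}. w \<noteq> x (fst p) / x (snd p) \<and> w\<^sup>2 \<noteq> x (fst p) / x (snd p)"
    proof (rule eventually_ball_finite)
      show "\<forall>p\<in>{p \<in> A \<times> A. fst p \<noteq> snd p}. \<forall>\<^sub>F w in at 1. w \<noteq> x (fst p) / x (snd p) \<and> w\<^sup>2 \<noteq> x (fst p) / x (snd p)"
      proof
        fix p assume p: "p \<in> {p \<in> A \<times> A. fst p \<noteq> snd p}"
        then have "x (fst p) \<noteq> x (snd p)" "x (snd p) \<noteq> 0"
          using assms(3,4) by (auto dest: inj_onD)
        then have "x (fst p) / x (snd p) \<noteq> 1" by simp
        then show "\<forall>\<^sub>F w in at 1. w \<noteq> x (fst p) / x (snd p) \<and> w\<^sup>2 \<noteq> x (fst p) / x (snd p)"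
          by (intro eventually_conj ev ev2)
      qed
    qed (use assms(2) in auto)
    moreover have "\<forall>\<^sub>F w in at 1. w \<noteq> (0::complex) \<and> w \<noteq> 1 \<and> w \<noteq> -1"
      by (intro eventually_conj ev)
    ultimately have "\<forall>\<^sub>F w in at 1. G w = 0"
    proof eventually_elim
      case (elim w)
      have w: "a * (w / a) = w" using assms(1) by simp
      show ?case unfolding G_def
      proof (rule ratio_sum_eq_0_indexed)
        fix i j assume ij: "i \<in> A" "j \<in> A" "i \<noteq> j"
        then have "x j \<noteq> 0" using assms(4) by auto
        then show "x i \<noteq> a * (w / a) * x j \<and> x i \<noteq> (a * (w / a))\<^sup>2 * x j"
          unfolding w using elim(1)[rule_format, of "(i, j)"] ij by auto
      qed (use elim(2) w assms(2-4) anti in \<open>auto simp: power2_eq_1_iff\<close>)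
    qed
    moreover have "isCont G 1"
      using calculation \<open>(G has_field_derivative _) (at 1)\<close> DERIV_isCont by blast
    ultimately have "(G \<longlongrightarrow> 0) (at 1)" "(G \<longlongrightarrow> G 1) (at 1)"
      by (auto simp: isCont_def tendsto_eventually)
    then have "G 1 = 0" using tendsto_unique[OF _ \<open>(G \<longlongrightarrow> G 1) (at 1)\<close>] by force
    have "\<forall>\<^sub>F w in nhds 1. G w = 0"
      using \<open>\<forall>\<^sub>F w in at 1. G w = 0\<close> \<open>G 1 = 0\<close> unfolding eventually_at_filter
      by (auto elim: eventually_mono)
    then show ?thesis
      using DERIV_cong_ev[of 1 1 G "\<lambda>_. 0" 0 0] by simp
  qed
  ultimately show ?thesis by (rule DERIV_unique)
qed

text \<open>\<open>\<psi>\<close> is the logarithmic \<open>w\<close>-derivative, in a form that also allows pairs for which the ratio vanishes.\<close>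

theorem functional_equation:
  assumes "a \<noteq> 0" "finite A" "inj_on x A" "0 \<notin> x ` A"
    and psi: "\<And>i j. i \<in> A \<Longrightarrow> j \<in> A \<Longrightarrow> i \<noteq> j \<Longrightarrow>
      ratio_deriv a (x i) (x j) = ratio a (1 / a) (x i) (x j) * \<psi> i j"
  shows "(\<Sum>B | B \<subseteq> A \<and> card B = p. cross (\<lambda>i j. ratio a (1 / a) (x i) (x j)) B (A - B) *
           (\<Sum>b\<in>B. \<Sum>c\<in>A - B. \<psi> b c - \<psi> c b)) = 0"
proof (cases "p \<le> card A")
  case False
  then have "card B \<noteq> p" if "B \<subseteq> A" for B
    using card_mono[OF assms(2) that] by auto
  then show ?thesis by (intro sum.neutral) auto
next
  case True
  let ?f = "\<lambda>i j. ratio a (1 / a) (x i) (x j)"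
  have sym: "?f i j = ?f j i" for i j
    using assms(1) ratio_reflect[of a "1 / a" "x i" "x j"] by simp
  define \<Psi> where "\<Psi> B C = cross ?f B C * (\<Sum>b\<in>B. \<Sum>c\<in>C. \<psi> b c)" for B C
  have crossC: "cross ?f B C = cross ?f C B" for B C
    unfolding cross_def by (subst prod.swap) (simp add: sym)
  \<comment> \<open>The weight [k = p] - [k = |A| - p] is antisymmetric. At w = 1 the ratio is
    symmetric, so complementing \<open>B\<close> turns the second half of the weight into an
    exchange of the arguments of \<open>\<psi>\<close>.\<close>
  define I where "I k = (if k = p then 1 else 0 :: complex)" for k
  have "(\<Sum>B\<in>Pow A. (I (card B) - I (card A - card B)) * \<Psi> B (A - B)) = 0"
    unfolding \<Psi>_def
    by (rule functional_equation_weighted[where v = "\<lambda>k. I k - I (card A - k)"])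
       (use assms in auto)
  then have "(\<Sum>B\<in>Pow A. I (card B) * \<Psi> B (A - B)) = (\<Sum>B\<in>Pow A. I (card A - card B) * \<Psi> B (A - B))"
    by (simp add: left_diff_distrib sum_subtractf)
  also have "\<dots> = (\<Sum>B\<in>Pow A. I (card B) * \<Psi> (A - B) B)"
    by (rule sum.reindex_bij_witness[of _ "\<lambda>B. A - B" "\<lambda>B. A - B"])
       (use assms(2) in \<open>auto simp: double_diff card_Diff_subset finite_subset\<close>)
  finally have "(\<Sum>B\<in>Pow A. I (card B) * (\<Psi> B (A - B) - \<Psi> (A - B) B)) = 0"
    by (simp add: right_diff_distrib sum_subtractf)
  moreover have "\<Psi> B C - \<Psi> C B = cross ?f B C * (\<Sum>b\<in>B. \<Sum>c\<in>C. \<psi> b c - \<psi> c b)" for B C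
  proof -
    have "(\<Sum>b\<in>C. \<Sum>c\<in>B. \<psi> b c) = (\<Sum>b\<in>B. \<Sum>c\<in>C. \<psi> c b)" by (rule sum.swap)
    then show ?thesis
      unfolding \<Psi>_def crossC[of C B] by (simp add: sum_subtractf algebra_simps)
  qed
  moreover have "(\<Sum>B | B \<subseteq> A \<and> card B = p. h B) = (\<Sum>B\<in>Pow A. I (card B) * h B)" for h
    by (rule sum.mono_neutral_cong_left) (use assms(2) in \<open>auto simp: I_def\<close>)
  ultimately show ?thesis by simp
qed

section \<open>The bracket in terms of weighted subsets\<close>

text \<open>With y_i = e^(-beta theta_i) and w_ik = f(q_i - q_k)^(1/2) this is the summand of h_l
  that belongs to \<open>I\<close>.\<close>

definition weight :: "('i \<Rightarrow> complex) \<Rightarrow> ('i \<Rightarrow> 'i \<Rightarrow> complex) \<Rightarrow> 'i::finite set \<Rightarrow> complex" where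
  "weight y w I = (\<Prod>i\<in>I. y i) * cross w I (- I)"

text \<open>If the odd kernel \<open>g\<close> is the logarithmic derivative of w in the difference
  of positions, this is the logarithmic derivative of \<open>weight y w I\<close> in q_j. Oddness is
  what allows one formula for j inside and outside \<open>I\<close>.\<close>

definition opposite_sum :: "('i \<Rightarrow> 'i \<Rightarrow> complex) \<Rightarrow> 'i \<Rightarrow> 'i::finite set \<Rightarrow> complex" where
  "opposite_sum g j I = (\<Sum>k\<in>(if j \<in> I then - I else I). g j k)"

lemma cross_Un_left:
  assumes "finite A" "finite B" "A \<inter> B = {}"
  shows "cross f (A \<union> B) C = cross f A C * cross f B C"
  using assms by (simp add: cross_def prod.union_disjoint)

lemma cross_Un_right:
  assumes "finite A" "finite B" "A \<inter> B = {}"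
  shows "cross f C (A \<union> B) = cross f C A * cross f C B"
  using assms by (simp add: cross_def prod.union_disjoint prod.distrib)

lemma cross_commute:
  assumes "\<And>i k. f i k = f k i"
  shows "cross f A B = cross f B A"
proof -
  have "cross f A B = cross (\<lambda>i k. f k i) B A"
    unfolding cross_def by (rule prod.swap)
  then show ?thesis by (simp flip: assms)
qed

lemma sum_sum_antisym:
  fixes g :: "'a \<Rightarrow> 'a \<Rightarrow> 'b::ab_group_add"
  assumes "\<And>i k. g i k = - g k i"
  shows "(\<Sum>a\<in>A. \<Sum>b\<in>B. g a b) = - (\<Sum>b\<in>B. \<Sum>a\<in>A. g b a)"
  by (subst sum.swap, subst assms) (simp add: sum_negf)

text \<open>In each sum the pairs between the intersection and \<open>I - J\<close> occur in both
  orders and cancel. The pairs joining the intersection to the outside of the union are common to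
  both sums. What is left are the pairs between the two differences, once with each sign, hence the
  factor 2.\<close>

lemma opposite_sum_difference:
  fixes I J :: "'i::finite set"
  assumes anti: "\<And>i k. g i k = - g k i"
  shows "(\<Sum>j\<in>I. opposite_sum g j J) - (\<Sum>j\<in>J. opposite_sum g j I)
       = 2 * (\<Sum>b\<in>I - J. \<Sum>c\<in>J - I. g b c)"
proof -
  let ?s = "\<lambda>A B. \<Sum>a\<in>A. \<Sum>b\<in>B. g a b"
  have half: "(\<Sum>j\<in>I. opposite_sum g j J)
      = ?s (I \<inter> J) (- (I \<union> J)) + ?s (I \<inter> J) (I - J) + ?s (I - J) (I \<inter> J) + ?s (I - J) (J - I)"
    for I J :: "'i set"
  proof -
    have "(\<Sum>j\<in>I. opposite_sum g j J) = (\<Sum>j\<in>(I \<inter> J) \<union> (I - J). opposite_sum g j J)"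
      by (simp add: Int_Diff_Un)
    also have "\<dots> = (\<Sum>j\<in>I \<inter> J. opposite_sum g j J) + (\<Sum>j\<in>I - J. opposite_sum g j J)"
      by (rule sum.union_disjoint) auto
    also have "(\<Sum>j\<in>I \<inter> J. opposite_sum g j J) = ?s (I \<inter> J) (- J)"
      by (intro sum.cong) (auto simp: opposite_sum_def)
    also have "- J = (- (I \<union> J)) \<union> (I - J)" by auto
    also have "?s (I \<inter> J) ((- (I \<union> J)) \<union> (I - J)) = ?s (I \<inter> J) (- (I \<union> J)) + ?s (I \<inter> J) (I - J)"
      by (subst sum.union_disjoint) (auto simp: sum.distrib)
    also have "(\<Sum>j\<in>I - J. opposite_sum g j J) = ?s (I - J) J"
      by (intro sum.cong) (auto simp: opposite_sum_def)
    also have "?s (I - J) J = ?s (I - J) ((I \<inter> J) \<union> (J - I))"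
      by (simp add: Int_commute[of I] Int_Diff_Un)
    also have "\<dots> = ?s (I - J) (I \<inter> J) + ?s (I - J) (J - I)"
      by (subst sum.union_disjoint) (auto simp: sum.distrib)
    finally show ?thesis by (simp add: add.assoc)
  qed
  have "?s A B = - ?s B A" for A B
    by (rule sum_sum_antisym) (rule anti)
  note c = this[of "I \<inter> J" "I - J"] this[of "J \<inter> I" "J - I"] this[of "J - I" "I - J"]
  show ?thesis
    unfolding half[of I J] half[of J I] c by (simp add: Int_commute Un_commute)
qed

text \<open>The only factor that depends on how \<open>B \<union> C\<close> is divided is the one
  between \<open>B\<close> and \<open>C\<close>. It occurs once in each weight, so the square roots
  combine to \<open>f\<close> itself, and the functional equation is free of roots.\<close>

lemma weight_mult:
  fixes A B C :: "'i::finite set"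
  assumes sym: "\<And>i k. w i k = w k i" and disj: "A \<inter> B = {}" "A \<inter> C = {}" "B \<inter> C = {}"
  shows "weight y w (A \<union> B) * weight y w (A \<union> C)
       = ((\<Prod>i\<in>A. y i) ^ 2 * (\<Prod>i\<in>B \<union> C. y i) * cross w A (- (A \<union> B \<union> C)) ^ 2
           * cross w A (B \<union> C) * cross w (B \<union> C) (- (A \<union> B \<union> C)))
         * cross (\<lambda>i k. (w i k)\<^sup>2) B C"
proof -
  let ?D = "- (A \<union> B \<union> C)"
  have 1: "- (A \<union> B) = C \<union> ?D" "- (A \<union> C) = B \<union> ?D"
    using disj by auto
  have 2: "cross (\<lambda>i k. (w i k)\<^sup>2) B C = cross w B C * cross w C B"
    unfolding cross_commute[of w C B, OF sym]
    by (simp add: cross_def power2_eq_square prod.distrib)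
  have d: "C \<inter> ?D = {}" "B \<inter> ?D = {}" by auto
  show ?thesis
    unfolding weight_def 1 2
    by (simp add: cross_Un_left cross_Un_right prod.union_disjoint disj d power2_eq_square mult_ac)
qed

text \<open>For fixed intersection and symmetric difference the prefactor of
  \<open>weight_mult\<close> comes out of the sum, and the functional equation on \<open>E\<close>
  remains.\<close>

lemma bracket_fibre_eq_0:
  fixes A E :: "'i::finite set"
  assumes sym: "\<And>i k. w i k = w k i" and anti: "\<And>i k. g i k = - g k i"
    and fe: "\<And>E p. (\<Sum>B | B \<subseteq> E \<and> card B = p. cross (\<lambda>i k. (w i k)\<^sup>2) B (E - B) *
               (\<Sum>b\<in>B. \<Sum>c\<in>E - B. g b c)) = 0"
    and "A \<inter> E = {}" "card A \<le> k"
  shows "(\<Sum>B | B \<subseteq> E \<and> card B = k - card A.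
      weight y w (A \<union> B) * weight y w (A \<union> (E - B)) *
      ((\<Sum>j\<in>A \<union> B. opposite_sum g j (A \<union> (E - B))) - (\<Sum>j\<in>A \<union> (E - B). opposite_sum g j (A \<union> B)))) = 0"
proof -
  let ?c = "(\<Prod>i\<in>A. y i) ^ 2 * (\<Prod>i\<in>E. y i) * cross w A (- (A \<union> E)) ^ 2
           * cross w A E * cross w E (- (A \<union> E))"
  have "weight y w (A \<union> B) * weight y w (A \<union> (E - B)) *
      ((\<Sum>j\<in>A \<union> B. opposite_sum g j (A \<union> (E - B))) - (\<Sum>j\<in>A \<union> (E - B). opposite_sum g j (A \<union> B)))
      = 2 * ?c * (cross (\<lambda>i k. (w i k)\<^sup>2) B (E - B) * (\<Sum>b\<in>B. \<Sum>c\<in>E - B. g b c))"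
    if "B \<subseteq> E" for B
  proof -
    have 1: "A \<union> B - (A \<union> (E - B)) = B" "A \<union> (E - B) - (A \<union> B) = E - B" "A \<union> B \<union> (E - B) = A \<union> E" "B \<union> (E - B) = E"
      using that assms(4) by auto
    have 2: "A \<inter> B = {}" "A \<inter> (E - B) = {}" "B \<inter> (E - B) = {}"
      using that assms(4) by auto
    show ?thesis
      unfolding opposite_sum_difference[OF anti] weight_mult[OF sym 2] 1
      by simp
  qed
  then have "(\<Sum>B | B \<subseteq> E \<and> card B = k - card A.
      weight y w (A \<union> B) * weight y w (A \<union> (E - B)) *
      ((\<Sum>j\<in>A \<union> B. opposite_sum g j (A \<union> (E - B))) - (\<Sum>j\<in>A \<union> (E - B). opposite_sum g j (A \<union> B))))
    = (\<Sum>B | B \<subseteq> E \<and> card B = k - card A. 2 * ?c * (cross (\<lambda>i k. (w i k)\<^sup>2) B (E - B) * (\<Sum>b\<in>B. \<Sum>c\<in>E - B. g b c)))"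
    by (intro sum.cong) auto
  also have "\<dots> = 2 * ?c * (\<Sum>B | B \<subseteq> E \<and> card B = k - card A. cross (\<lambda>i k. (w i k)\<^sup>2) B (E - B) * (\<Sum>b\<in>B. \<Sum>c\<in>E - B. g b c))"
    by (simp only: sum_distrib_left)
  finally show ?thesis by (simp add: fe)
qed

theorem sum_weight_bracket_eq_0:
  fixes w g :: "'i::finite \<Rightarrow> 'i \<Rightarrow> complex"
  assumes sym: "\<And>i k. w i k = w k i" and anti: "\<And>i k. g i k = - g k i"
    and fe: "\<And>E p. (\<Sum>B | B \<subseteq> E \<and> card B = p. cross (\<lambda>i k. (w i k)\<^sup>2) B (E - B) *
               (\<Sum>b\<in>B. \<Sum>c\<in>E - B. g b c)) = 0"
  shows "(\<Sum>I | card I = k. \<Sum>J | card J = l. weight y w I * weight y w J *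
      ((\<Sum>j\<in>I. opposite_sum g j J) - (\<Sum>j\<in>J. opposite_sum g j I))) = 0"
proof -
  let ?h = "\<lambda>I J. weight y w I * weight y w J *
      ((\<Sum>j\<in>I. opposite_sum g j J) - (\<Sum>j\<in>J. opposite_sum g j I))"
  let ?P = "{I. card I = k} \<times> {J. card J = l} :: ('i set \<times> 'i set) set"
  let ?\<kappa> = "\<lambda>(I, J). (I \<inter> J, (I - J) \<union> (J - I)) :: 'i set \<times> 'i set"
  have "(\<Sum>I | card I = k. \<Sum>J | card J = l. ?h I J) = (\<Sum>p\<in>?P. case p of (I, J) \<Rightarrow> ?h I J)"
    by (rule sum.cartesian_product)
  also have "\<dots> = (\<Sum>q\<in>UNIV. \<Sum>p\<in>{p \<in> ?P. ?\<kappa> p = q}. case p of (I, J) \<Rightarrow> ?h I J)"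
    by (rule sum.group[symmetric]) auto
  also have "\<dots> = 0"
  proof (rule sum.neutral, rule ballI)
    fix q :: "'i set \<times> 'i set"
    obtain A E where q: "q = (A, E)" by (cases q)
    show "(\<Sum>p\<in>{p \<in> ?P. ?\<kappa> p = q}. case p of (I, J) \<Rightarrow> ?h I J) = 0"
    proof (cases "\<exists>I0 J0. (I0, J0) \<in> ?P \<and> ?\<kappa> (I0, J0) = q")
      case False
      then have none: "{p \<in> ?P. ?\<kappa> p = q} = {}" by (auto simp del: mem_Times_iff)
      show ?thesis unfolding none by simp
    next
      case True
      then obtain I0 J0 where 0: "card I0 = k" "card J0 = l" "A = I0 \<inter> J0" "E = (I0 - J0) \<union> (J0 - I0)"
        using q by auto
      have AE: "A \<inter> E = {}" using 0 by auto
      have cA: "card A \<le> k" using 0 by (auto intro: card_mono)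
      \<comment> \<open>The sizes determine each other: once |B| = k - |A|, the complement of B in E
        automatically has l - |A| elements.\<close>
      have kl: "k + l = card E + 2 * card A"
      proof -
        have "card E = card (I0 - J0) + card (J0 - I0)"
          unfolding 0 by (rule card_Un_disjoint) auto
        moreover have "card I0 = card A + card (I0 - J0)" "card J0 = card A + card (J0 - I0)"
          unfolding 0(3) by (metis card_Int_Diff finite, metis card_Int_Diff finite Int_commute)
        ultimately show ?thesis using 0 by simp
      qed
      have "(\<Sum>p\<in>{p \<in> ?P. ?\<kappa> p = q}. case p of (I, J) \<Rightarrow> ?h I J)
        = (\<Sum>B | B \<subseteq> E \<and> card B = k - card A. ?h (A \<union> B) (A \<union> (E - B)))"
      proof (rule sum.reindex_bij_witness[of _ "\<lambda>B. (A \<union> B, A \<union> (E - B))" "\<lambda>(I, J). I - J"])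
        fix p assume "p \<in> {p \<in> ?P. ?\<kappa> p = q}"
        then obtain I J where p: "p = (I, J)" "card I = k" "card J = l" "A = I \<inter> J" "E = (I - J) \<union> (J - I)"
          using q by auto
        have "card I = card A + card (I - J)" unfolding p(4) by (metis card_Int_Diff finite)
        then show "(case p of (I, J) \<Rightarrow> I - J) \<in> {B. B \<subseteq> E \<and> card B = k - card A}"
          using p by auto
        have e: "A \<union> (I - J) = I" "A \<union> (E - (I - J)) = J" using p by auto
        show "(A \<union> (case p of (I, J) \<Rightarrow> I - J), A \<union> (E - (case p of (I, J) \<Rightarrow> I - J))) = p"
          using e p by simp
        show "?h (A \<union> (case p of (I, J) \<Rightarrow> I - J)) (A \<union> (E - (case p of (I, J) \<Rightarrow> I - J)))
          = (case p of (I, J) \<Rightarrow> ?h I J)"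
          unfolding p(1) prod.case e ..
      next
        fix B assume "B \<in> {B. B \<subseteq> E \<and> card B = k - card A}"
        then have B: "B \<subseteq> E" "card B = k - card A" by auto
        show "(case (A \<union> B, A \<union> (E - B)) of (I, J) \<Rightarrow> I - J) = B" using B AE by auto
        have "card (A \<union> B) = card A + card B" "card (A \<union> (E - B)) = card A + card (E - B)"
          by (rule card_Un_disjoint; use B AE in auto)+
        moreover have "card (E - B) = card E - card B" "card B \<le> card E"
          using B(1) by (simp_all add: card_Diff_subset card_mono)
        ultimately have "card (A \<union> B) = k" "card (A \<union> (E - B)) = l"
          using B cA kl by auto
        moreover have "?\<kappa> (A \<union> B, A \<union> (E - B)) = (A, E)" using B AE by auto
        ultimately show "(A \<union> B, A \<union> (E - B)) \<in> {p \<in> ?P. ?\<kappa> p = q}"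
          using q by auto
      qed
      also have "\<dots> = 0" by (rule bracket_fibre_eq_0[OF sym anti fe AE cA])
      finally show ?thesis .
    qed
  qed
  finally show ?thesis .
qed

text \<open>Up to the factor -beta this is the derivative of h_k in theta_i.\<close>

definition occupation_sum :: "('i \<Rightarrow> complex) \<Rightarrow> ('i \<Rightarrow> 'i \<Rightarrow> complex) \<Rightarrow> nat \<Rightarrow> 'i::finite \<Rightarrow> complex" where
  "occupation_sum y w k i = (\<Sum>I | card I = k. weight y w I * of_bool (i \<in> I))"

text \<open>The derivative of h_k in q_i, for \<open>g\<close> the logarithmic derivative of
  w.\<close>

definition force_sum ::
    "('i \<Rightarrow> complex) \<Rightarrow> ('i \<Rightarrow> 'i \<Rightarrow> complex) \<Rightarrow> ('i \<Rightarrow> 'i \<Rightarrow> complex) \<Rightarrow> nat \<Rightarrow> 'i::finite \<Rightarrow> complex" where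
  "force_sum y w g k i = (\<Sum>I | card I = k. weight y w I * opposite_sum g i I)"

text \<open>This is {h_k, h_l} = 0 on the full phase space, up to the factor -beta: exchanging sums
  recovers the double sum over index sets.\<close>

corollary full_bracket_eq_0:
  fixes w g :: "'i::finite \<Rightarrow> 'i \<Rightarrow> complex"
  assumes "\<And>i k. w i k = w k i" and "\<And>i k. g i k = - g k i"
    and "\<And>E p. (\<Sum>B | B \<subseteq> E \<and> card B = p. cross (\<lambda>i k. (w i k)\<^sup>2) B (E - B) *
               (\<Sum>b\<in>B. \<Sum>c\<in>E - B. g b c)) = 0"
  shows "(\<Sum>i\<in>UNIV. occupation_sum y w k i * force_sum y w g l i)
       = (\<Sum>i\<in>UNIV. force_sum y w g k i * occupation_sum y w l i)"
proof -
  have b: "(\<Sum>j\<in>I. h j) = (\<Sum>j\<in>UNIV. of_bool (j \<in> I) * h j)" for I :: "'i set" and h :: "'i \<Rightarrow> complex"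
    by (rule sum.mono_neutral_cong_left) auto
  have 1: "(\<Sum>i\<in>UNIV. occupation_sum y w k i * force_sum y w g l i)
      = (\<Sum>I | card I = k. \<Sum>J | card J = l. weight y w I * weight y w J * (\<Sum>j\<in>I. opposite_sum g j J))" for k l
  proof -
    have "(\<Sum>i\<in>UNIV. occupation_sum y w k i * force_sum y w g l i)
      = (\<Sum>i\<in>UNIV. \<Sum>I | card I = k. \<Sum>J | card J = l.
          weight y w I * weight y w J * (of_bool (i \<in> I) * opposite_sum g i J))"
      unfolding occupation_sum_def force_sum_def sum_product by (intro sum.cong refl) simp
    also have "\<dots> = (\<Sum>I | card I = k. \<Sum>J | card J = l. \<Sum>i\<in>UNIV.
          weight y w I * weight y w J * (of_bool (i \<in> I) * opposite_sum g i J))"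
      by (subst sum.swap, rule sum.cong[OF refl], rule sum.swap)
    also have "\<dots> = (\<Sum>I | card I = k. \<Sum>J | card J = l. weight y w I * weight y w J * (\<Sum>j\<in>I. opposite_sum g j J))"
      unfolding sum_distrib_left[symmetric] by (intro sum.cong refl arg_cong2[of _ _ _ _ "(*)"] b[symmetric])
    finally show ?thesis .
  qed
  have 2: "(\<Sum>i\<in>UNIV. force_sum y w g k i * occupation_sum y w l i)
      = (\<Sum>I | card I = k. \<Sum>J | card J = l. weight y w I * weight y w J * (\<Sum>j\<in>J. opposite_sum g j I))"
  proof -
    have "(\<Sum>i\<in>UNIV. force_sum y w g k i * occupation_sum y w l i)
      = (\<Sum>J | card J = l. \<Sum>I | card I = k. weight y w J * weight y w I * (\<Sum>j\<in>J. opposite_sum g j I))"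
      unfolding 1[symmetric] by (simp add: mult.commute)
    then show ?thesis
      by (subst (asm) sum.swap) (simp add: mult.commute)
  qed
  show ?thesis
    using sum_weight_bracket_eq_0[OF assms, where k = k and l = l and y = y] unfolding 1 2
    by (simp add: right_diff_distrib sum_subtractf)
qed

section \<open>Restriction to the fixed points of the reflection\<close>

text \<open>\<open>prod_y\<close> does not follow from \<open>y_reflect\<close>, which would allow
  y_i = -1 at a fixed index. On the locus it holds because fixed indices have rapidity 0.\<close>

locale reflected_weights =
  fixes \<sigma> :: "'i::finite \<Rightarrow> 'i" and y :: "'i \<Rightarrow> complex" and w :: "'i \<Rightarrow> 'i \<Rightarrow> complex"
  assumes involution: "\<sigma> (\<sigma> i) = i"
    and y_reflect: "y i * y (\<sigma> i) = 1"
    and prod_y: "(\<Prod>i\<in>UNIV. y i) = 1"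
    and w_sym: "w i k = w k i"
    and w_reflect: "w (\<sigma> i) (\<sigma> k) = w i k"
begin

lemma sigma_bij: "bij \<sigma>"
  by (rule involuntory_imp_bij) (rule involution)

lemma sigma_inj: "inj_on \<sigma> A"
  using sigma_bij by (meson bij_is_inj inj_on_subset subset_UNIV)

definition reflect :: "'i set \<Rightarrow> 'i set" where
  "reflect I = - (\<sigma> ` I)"

lemma reflect_reflect: "reflect (reflect I) = I"
  unfolding reflect_def bij_image_Compl_eq[OF sigma_bij, symmetric]
  by (simp add: image_image involution)

lemma mem_reflect: "i \<in> reflect I \<longleftrightarrow> \<sigma> i \<notin> I"
  unfolding reflect_def using involution by (force simp: image_iff)

lemma card_reflect: "card (reflect I) = CARD('i) - card I"
  unfolding reflect_def by (simp add: Compl_eq_Diff_UNIV card_Diff_subset card_image sigma_inj)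

lemma sum_reflect:
  assumes "k \<le> CARD('i)"
  shows "(\<Sum>I | card I = k. h (reflect I)) = (\<Sum>I | card I = CARD('i) - k. h I)"
  by (rule sum.reindex_bij_witness[of _ reflect reflect])
     (use assms in \<open>auto simp: reflect_reflect card_reflect\<close>)

text \<open>Both sigma and, because the total product is 1, complementation invert the product of
  the y_i, so together they preserve it. In the crossing factor complementation exchanges the two
  arguments, which the symmetry of w absorbs.\<close>

lemma weight_reflect: "weight y w (reflect I) = weight y w I"
proof -
  have nz: "y i \<noteq> 0" for i using y_reflect[of i] by auto
  have "(\<Prod>i\<in>\<sigma> ` I. y i) * (\<Prod>i\<in>I. y i) = (\<Prod>i\<in>I. y (\<sigma> i) * y i)"
    by (simp add: prod.reindex sigma_inj prod.distrib)
  also have "\<dots> = 1" using y_reflect by (simp add: mult.commute)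
  finally have 1: "(\<Prod>i\<in>\<sigma> ` I. y i) * (\<Prod>i\<in>I. y i) = 1" .
  have "(\<Prod>i\<in>\<sigma> ` I. y i) * (\<Prod>i\<in>- (\<sigma> ` I). y i) = (\<Prod>i\<in>\<sigma> ` I \<union> - (\<sigma> ` I). y i)"
    by (rule prod.union_disjoint[symmetric]) auto
  also have "\<dots> = 1" using prod_y by (simp add: Compl_partition)
  finally have "(\<Prod>i\<in>\<sigma> ` I. y i) * (\<Prod>i\<in>- (\<sigma> ` I). y i) = (\<Prod>i\<in>\<sigma> ` I. y i) * (\<Prod>i\<in>I. y i)"
    using 1 by simp
  then have y: "(\<Prod>i\<in>reflect I. y i) = (\<Prod>i\<in>I. y i)"
    using nz by (simp add: reflect_def)
  have "cross w (reflect I) (- reflect I) = cross w (\<sigma> ` I) (\<sigma> ` (- I))"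
    unfolding reflect_def bij_image_Compl_eq[OF sigma_bij, symmetric] double_complement
    by (subst cross_commute[of w, OF w_sym]) (simp add: bij_image_Compl_eq[OF sigma_bij])
  also have "\<dots> = cross w I (- I)"
    unfolding cross_def by (simp add: prod.reindex sigma_inj w_reflect)
  finally show ?thesis by (simp add: weight_def y)
qed

lemma sum_weight_complementary:
  assumes "k \<le> CARD('i)"
  shows "(\<Sum>I | card I = CARD('i) - k. weight y w I) = (\<Sum>I | card I = k. weight y w I)"
  using sum_reflect[OF assms, of "weight y w"] by (simp add: weight_reflect)

text \<open>Membership in \<open>reflect I\<close> is non-membership of the reflected index in
  \<open>I\<close>, so the indicators add up to 1 and leave h_k as a constant independent of
  i.\<close>

lemma occupation_sum_reflect:
  assumes "k \<le> CARD('i)"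
  shows "occupation_sum y w k (\<sigma> i)
       = (\<Sum>I | card I = k. weight y w I) - occupation_sum y w (CARD('i) - k) i"
proof -
  have "occupation_sum y w (CARD('i) - k) i = (\<Sum>I | card I = k. weight y w I * of_bool (\<sigma> i \<notin> I))"
    unfolding occupation_sum_def sum_reflect[OF assms, symmetric] by (simp add: weight_reflect mem_reflect)
  also have "\<dots> + occupation_sum y w k (\<sigma> i) = (\<Sum>I | card I = k. weight y w I)"
    unfolding occupation_sum_def sum.distrib[symmetric] by (intro sum.cong refl) simp
  finally show ?thesis by (simp add: algebra_simps)
qed

end

lemma opposite_sum_Compl: "opposite_sum g j (- I) = opposite_sum g j I"
  by (simp add: opposite_sum_def)

lemma sum_opposite_sum_eq_0:
  assumes "\<And>i k. g i k = - g k i"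
  shows "(\<Sum>j\<in>UNIV. opposite_sum g j I) = 0"
proof -
  have "(\<Sum>j\<in>UNIV. opposite_sum g j I) = (\<Sum>j\<in>I. opposite_sum g j I) + (\<Sum>j\<in>- I. opposite_sum g j I)"
    by (subst sum.union_disjoint[symmetric]) auto
  also have "(\<Sum>j\<in>I. opposite_sum g j I) = (\<Sum>j\<in>I. \<Sum>k\<in>- I. g j k)"
    by (intro sum.cong) (auto simp: opposite_sum_def)
  also have "\<dots> = - (\<Sum>j\<in>- I. \<Sum>k\<in>I. g j k)"
    by (rule sum_sum_antisym) (rule assms)
  also have "(\<Sum>j\<in>- I. opposite_sum g j I) = (\<Sum>j\<in>- I. \<Sum>k\<in>I. g j k)"
    by (intro sum.cong) (auto simp: opposite_sum_def)
  finally show ?thesis by simp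
qed

text \<open>Translation invariance: h_k depends on differences of positions only.\<close>

lemma sum_force_sum_eq_0:
  assumes "\<And>i k. g i k = - g k i"
  shows "(\<Sum>i\<in>UNIV. force_sum y w g k i) = 0"
  unfolding force_sum_def
  by (subst sum.swap) (simp add: sum_opposite_sum_eq_0[of g, OF assms] flip: sum_distrib_left)

locale reflected_forces = reflected_weights \<sigma> y w
  for \<sigma> :: "'i::finite \<Rightarrow> 'i" and y w +
  fixes g :: "'i \<Rightarrow> 'i \<Rightarrow> complex"
  assumes g_antisym: "g i k = - g k i"
    and g_reflect: "g (\<sigma> i) (\<sigma> k) = - g i k"
    and functional: "(\<Sum>B | B \<subseteq> E \<and> card B = p. cross (\<lambda>i k. (w i k)\<^sup>2) B (E - B) *
               (\<Sum>b\<in>B. \<Sum>c\<in>E - B. g b c)) = 0"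
begin

lemma opposite_sum_reflect: "opposite_sum g i (reflect I) = - opposite_sum g (\<sigma> i) I"
proof -
  have "(\<Sum>k\<in>\<sigma> ` J. g i k) = - (\<Sum>k\<in>J. g (\<sigma> i) k)" for J
    using g_reflect[of "\<sigma> i"] by (simp add: sum.reindex sigma_inj involution sum_negf)
  moreover have "- \<sigma> ` I = \<sigma> ` (- I)" by (simp add: bij_image_Compl_eq[OF sigma_bij])
  moreover have "i \<in> \<sigma> ` I \<longleftrightarrow> \<sigma> i \<in> I" using mem_reflect[of i I] by (simp add: reflect_def)
  ultimately show ?thesis
    unfolding reflect_def opposite_sum_Compl by (simp add: opposite_sum_def)
qed

lemma force_sum_reflect:
  assumes "k \<le> CARD('i)"
  shows "force_sum y w g k (\<sigma> i) = - force_sum y w g (CARD('i) - k) i"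
  unfolding force_sum_def sum_reflect[OF assms, symmetric]
  by (simp add: weight_reflect opposite_sum_reflect sum_negf)

text \<open>The summand vanishes at fixed indices and is invariant under sigma, so the sum over all
  indices is twice the sum over \<open>R\<close>. Over all indices the terms mixing i with its
  reflection become brackets with k replaced by n + 1 - k.\<close>

theorem rest_bracket_weights_eq_0:
  assumes R: "R \<inter> \<sigma> ` R = {}" "R \<union> \<sigma> ` R = {i. \<sigma> i \<noteq> i}"
    and kl: "k \<le> CARD('i)" "l \<le> CARD('i)"
  shows "(\<Sum>i\<in>R. (occupation_sum y w k i - occupation_sum y w k (\<sigma> i)) *
                  (force_sum y w g l i - force_sum y w g l (\<sigma> i))
                - (force_sum y w g k i - force_sum y w g k (\<sigma> i)) *
                  (occupation_sum y w l i - occupation_sum y w l (\<sigma> i))) = 0"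
proof -
  let ?t = "occupation_sum y w" and ?q = "force_sum y w g"
  let ?X = "\<lambda>i. (?t k i - ?t k (\<sigma> i)) * (?q l i - ?q l (\<sigma> i)) - (?q k i - ?q k (\<sigma> i)) * (?t l i - ?t l (\<sigma> i))"
  let ?N = "CARD('i)"
  have full: "(\<Sum>i\<in>UNIV. ?t k i * ?q l i) = (\<Sum>i\<in>UNIV. ?q k i * ?t l i)" for k l
    by (rule full_bracket_eq_0[OF w_sym g_antisym functional])
  have q0: "(\<Sum>i\<in>UNIV. ?q l i) = 0" for l
    by (rule sum_force_sum_eq_0[OF g_antisym])
  have reindex: "(\<Sum>i\<in>UNIV. h (\<sigma> i)) = (\<Sum>i\<in>UNIV. h i)" for h :: "'i \<Rightarrow> complex"
    by (rule sum.reindex_bij_betw[OF sigma_bij])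
  have diff: "(\<Sum>i\<in>UNIV. (h i - h (\<sigma> i)) * (h' i - h' (\<sigma> i)))
      = 2 * ((\<Sum>i\<in>UNIV. h i * h' i) - (\<Sum>i\<in>UNIV. h i * h' (\<sigma> i)))" for h h' :: "'i \<Rightarrow> complex"
  proof -
    have "(\<Sum>i\<in>UNIV. h (\<sigma> i) * h' (\<sigma> i)) = (\<Sum>i\<in>UNIV. h i * h' i)"
      by (rule reindex)
    moreover have "(\<Sum>i\<in>UNIV. h (\<sigma> i) * h' i) = (\<Sum>i\<in>UNIV. h i * h' (\<sigma> i))"
      using reindex[of "\<lambda>i. h i * h' (\<sigma> i)"] by (simp add: involution)
    ultimately show ?thesis
      by (simp add: algebra_simps sum.distrib sum_subtractf)
  qed
  \<comment> \<open>The constant h_k from \<open>occupation_sum_reflect\<close> is multiplied by the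
    total force, which is 0.\<close>
  have 1: "(\<Sum>i\<in>UNIV. ?q l i * ?t k (\<sigma> i)) = - (\<Sum>i\<in>UNIV. ?q l i * ?t (?N - k) i)"
    using q0 by (simp add: occupation_sum_reflect[OF kl(1)] right_diff_distrib sum_subtractf
        flip: sum_distrib_right)
  have 2: "(\<Sum>i\<in>UNIV. ?t l i * ?q k (\<sigma> i)) = - (\<Sum>i\<in>UNIV. ?t l i * ?q (?N - k) i)"
    by (simp add: force_sum_reflect[OF kl(1)] sum_negf)
  have "(\<Sum>i\<in>UNIV. ?X i) = (\<Sum>i\<in>UNIV. (?q l i - ?q l (\<sigma> i)) * (?t k i - ?t k (\<sigma> i)))
      - (\<Sum>i\<in>UNIV. (?t l i - ?t l (\<sigma> i)) * (?q k i - ?q k (\<sigma> i)))"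
    by (simp add: sum_subtractf mult.commute)
  also have "\<dots> = 0"
    unfolding diff 1 2 using full[of k l] full[of "?N - k" l] by (simp add: mult.commute)
  finally have X0: "(\<Sum>i\<in>UNIV. ?X i) = 0" .
  have "(\<Sum>i\<in>UNIV. ?X i) = (\<Sum>i\<in>R \<union> \<sigma> ` R. ?X i)"
    by (rule sum.mono_neutral_right) (auto simp: R(2))
  also have "\<dots> = (\<Sum>i\<in>R. ?X i) + (\<Sum>i\<in>\<sigma> ` R. ?X i)"
    by (rule sum.union_disjoint) (use R(1) in auto)
  also have "(\<Sum>i\<in>\<sigma> ` R. ?X i) = (\<Sum>i\<in>R. ?X i)"
    by (subst sum.reindex[OF sigma_inj]) (simp add: involution algebra_simps)
  finally show ?thesis using X0 by simp
qed

end

section \<open>The Ruijsenaars-Schneider data\<close>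

definition rs_f_deriv :: "complex \<Rightarrow> complex \<Rightarrow> complex \<Rightarrow> complex" where
  "rs_f_deriv \<nu> \<gamma> q = \<nu> * (sinh \<gamma>)\<^sup>2 * cosh (\<nu> * q / 2) / (sinh (\<nu> * q / 2)) ^ 3"

definition rs_y :: "complex \<Rightarrow> 'i::finite phase \<Rightarrow> 'i \<Rightarrow> complex" where
  "rs_y \<beta> x i = exp (- \<beta> * snd x $ i)"

definition rs_w :: "complex \<Rightarrow> complex \<Rightarrow> 'i::finite phase \<Rightarrow> 'i \<Rightarrow> 'i \<Rightarrow> complex" where
  "rs_w \<nu> \<gamma> x i k = csqrt (rs_f \<nu> \<gamma> (fst x $ i - fst x $ k))"

text \<open>Half the logarithmic derivative of \<open>f\<close>. Where \<open>f\<close> vanishes, which on the submanifold is possible only for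
  the two fixed indices, division by zero gives the value 0; there \<open>f\<close> has a critical point.\<close>

definition rs_g :: "complex \<Rightarrow> complex \<Rightarrow> 'i::finite phase \<Rightarrow> 'i \<Rightarrow> 'i \<Rightarrow> complex" where
  "rs_g \<nu> \<gamma> x i k = rs_f_deriv \<nu> \<gamma> (fst x $ i - fst x $ k) / (2 * rs_f \<nu> \<gamma> (fst x $ i - fst x $ k))"

lemma rs_h_eq_sum_weight:
  "rs_h \<beta> \<nu> \<gamma> l x = (\<Sum>I | card I = l. weight (rs_y \<beta> x) (rs_w \<nu> \<gamma> x) I)"
  by (simp add: rs_h_def weight_def rs_fI_def cross_def rs_y_def rs_w_def sum_distrib_left exp_sum)

lemma rs_f_has_field_derivative:
  assumes "sinh (\<nu> * q / 2) \<noteq> 0"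
  shows "(rs_f \<nu> \<gamma> has_field_derivative rs_f_deriv \<nu> \<gamma> q) (at q)"
proof -
  have sh: "((\<lambda>q. sinh (\<nu> * q / 2)) has_field_derivative cosh (\<nu> * q / 2) * (\<nu> / 2)) (at q)"
    by (rule derivative_eq_intros refl | simp)+
  have "((\<lambda>q. 1 - (sinh \<gamma>)\<^sup>2 / (sinh (\<nu> * q / 2))\<^sup>2) has_field_derivative
      - ((0 * (sinh (\<nu> * q / 2))\<^sup>2 - (sinh \<gamma>)\<^sup>2 * (2 * sinh (\<nu> * q / 2) * (cosh (\<nu> * q / 2) * (\<nu> / 2))))
        / ((sinh (\<nu> * q / 2))\<^sup>2 * (sinh (\<nu> * q / 2))\<^sup>2))) (at q)"
    by (rule derivative_eq_intros sh refl | use assms in simp)+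
  also have "- ((0 * (sinh (\<nu> * q / 2))\<^sup>2 - (sinh \<gamma>)\<^sup>2 * (2 * sinh (\<nu> * q / 2) * (cosh (\<nu> * q / 2) * (\<nu> / 2))))
        / ((sinh (\<nu> * q / 2))\<^sup>2 * (sinh (\<nu> * q / 2))\<^sup>2)) = rs_f_deriv \<nu> \<gamma> q"
    using assms unfolding rs_f_deriv_def by (simp add: field_simps power2_eq_square power3_eq_cube)
  finally show ?thesis
    unfolding rs_f_def[abs_def] .
qed

lemma sinh_half_eq:
  fixes t :: complex
  shows "sinh (t / 2) = (exp t - 1) / (2 * exp (t / 2))" "cosh (t / 2) = (exp t + 1) / (2 * exp (t / 2))"
proof -
  have "exp t = exp (t / 2) * exp (t / 2)" by (simp flip: exp_add)
  then show "sinh (t / 2) = (exp t - 1) / (2 * exp (t / 2))" "cosh (t / 2) = (exp t + 1) / (2 * exp (t / 2))"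
    by (simp_all add: sinh_field_def cosh_field_def exp_minus field_simps)
qed

lemma rs_f_exp: "rs_f \<nu> \<gamma> q = 1 - 4 * (sinh \<gamma>)\<^sup>2 * exp (\<nu> * q) / (exp (\<nu> * q) - 1)\<^sup>2"
proof -
  have "exp (\<nu> * q) = (exp (\<nu> * q / 2))\<^sup>2" by (simp add: exp_double[symmetric])
  then show ?thesis
    unfolding rs_f_def sinh_half_eq by (simp add: power_divide power_mult_distrib field_simps)
qed

lemma rs_f_deriv_exp:
  "rs_f_deriv \<nu> \<gamma> q = \<nu> * (4 * (sinh \<gamma>)\<^sup>2) * exp (\<nu> * q) * (exp (\<nu> * q) + 1) / (exp (\<nu> * q) - 1) ^ 3"
proof -
  have z: "exp (\<nu> * q) = (exp (\<nu> * q / 2))\<^sup>2" by (simp add: exp_double[symmetric])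
  have "c / (2 * h) / (s / (2 * h)) ^ 3 = 4 * h\<^sup>2 * c / s ^ 3" if "h \<noteq> 0" for c s h :: complex
    using that by (simp add: power_divide power_mult_distrib power2_eq_square power3_eq_cube)
  from this[of "exp (\<nu> * q / 2)" "exp (\<nu> * q) + 1" "exp (\<nu> * q) - 1"]
  have "(exp (\<nu> * q) + 1) / (2 * exp (\<nu> * q / 2)) / ((exp (\<nu> * q) - 1) / (2 * exp (\<nu> * q / 2))) ^ 3
      = 4 * exp (\<nu> * q) * (exp (\<nu> * q) + 1) / (exp (\<nu> * q) - 1) ^ 3"
    unfolding z[symmetric] by simp
  from arg_cong[OF this, of "\<lambda>t. \<nu> * (sinh \<gamma>)\<^sup>2 * t"] show ?thesis
    unfolding rs_f_deriv_def sinh_half_eq by (simp only: times_divide_eq_right mult_ac)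
qed

lemma rs_f_minus: "rs_f \<nu> \<gamma> (- q) = rs_f \<nu> \<gamma> q"
  by (simp add: rs_f_def)

lemma rs_f_deriv_minus: "rs_f_deriv \<nu> \<gamma> (- q) = - rs_f_deriv \<nu> \<gamma> q"
  by (simp add: rs_f_deriv_def)

text \<open>Replaces congruences of positions by equations between the points z = e^(nu q), the
  variables of the functional equation.\<close>

lemma congmod_rs_T_iff:
  assumes "\<nu> \<noteq> 0"
  shows "congmod (rs_T \<nu>) p q \<longleftrightarrow> exp (\<nu> * p) = exp (\<nu> * q)"
proof -
  have "exp (\<nu> * p) = exp (\<nu> * q) \<longleftrightarrow> (\<exists>n::int. \<nu> * p = \<nu> * q + of_int (2 * n) * of_real pi * \<i>)"
    by (simp add: exp_eq)
  also have "\<dots> \<longleftrightarrow> (\<exists>n::int. p - q = of_int n * rs_T \<nu>)"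
  proof (intro ex_cong1)
    fix n :: int
    show "\<nu> * p = \<nu> * q + of_int (2 * n) * of_real pi * \<i> \<longleftrightarrow> p - q = of_int n * rs_T \<nu>"
      using assms unfolding rs_T_def by (auto simp: field_simps)
  qed
  finally show ?thesis by (simp add: congmod_def)
qed

lemma exp_half_rs_T: "\<nu> \<noteq> 0 \<Longrightarrow> exp (\<nu> * (rs_T \<nu> / 2)) = -1"
  by (simp add: rs_T_def mult.commute)

lemma sinh_eq_0_iff_congmod:
  assumes "\<nu> \<noteq> 0"
  shows "sinh (\<nu> * (p - q) / 2) = 0 \<longleftrightarrow> congmod (rs_T \<nu>) p q"
  unfolding congmod_rs_T_iff[OF assms] sinh_half_eq
  by (simp add: right_diff_distrib exp_diff)

lemma rs_f_cong:
  assumes "exp (\<nu> * p) = exp (\<nu> * q)"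
  shows "rs_f \<nu> \<gamma> p = rs_f \<nu> \<gamma> q" "rs_f_deriv \<nu> \<gamma> p = rs_f_deriv \<nu> \<gamma> q"
  by (simp_all add: rs_f_exp rs_f_deriv_exp assms)

lemma four_sinh_sq: "4 * (sinh \<gamma>)\<^sup>2 = exp (2 * \<gamma>) + 1 / exp (2 * \<gamma>) - (2::complex)"
proof -
  have "exp (2 * \<gamma>) = exp \<gamma> * exp \<gamma>" by (simp flip: exp_add)
  then show ?thesis
    by (simp add: sinh_field_def exp_minus power2_eq_square field_simps)
qed

text \<open>With a = e^(2 gamma) one has 4 sinh^2 gamma = a + 1/a - 2, and (u - v)^2 - (a + 1/a - 2)
  u v factors as (u - a v)(u - v/a). Thus \<open>f\<close> is the deformed ratio at w = 1.\<close>

lemma rs_f_eq_ratio: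
  assumes "exp (\<nu> * p) \<noteq> exp (\<nu> * q)"
  shows "rs_f \<nu> \<gamma> (p - q) = ratio (exp (2 * \<gamma>)) (1 / exp (2 * \<gamma>)) (exp (\<nu> * p)) (exp (\<nu> * q))"
proof -
  have "1 - (a + 1 / a - 2) * (u / v) / (u / v - 1)\<^sup>2 = ratio a (1 / a) u v"
    if "a \<noteq> 0" "v \<noteq> 0" "u \<noteq> v" for a u v :: complex
  proof -
    have "(u / v) / (u / v - 1)\<^sup>2 = u * v / (u - v)\<^sup>2"
      using that by (simp add: field_simps power2_eq_square)
    then have "1 - (a + 1 / a - 2) * (u / v) / (u / v - 1)\<^sup>2 = ((u - v)\<^sup>2 - (a + 1 / a - 2) * (u * v)) / (u - v)\<^sup>2"
      using that by (simp add: diff_divide_distrib flip: times_divide_eq_right)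
    also have "(u - v)\<^sup>2 - (a + 1 / a - 2) * (u * v) = (u - a * v) * (u - 1 / a * v)"
      using that by (simp add: field_simps power2_eq_square)
    finally show ?thesis using that by (simp add: ratio_def power2_eq_square)
  qed
  from this[of "exp (2 * \<gamma>)" "exp (\<nu> * q)" "exp (\<nu> * p)"] assms show ?thesis
    unfolding rs_f_exp four_sinh_sq by (simp add: right_diff_distrib exp_diff)
qed

text \<open>The link between the two kinds of derivative: antisymmetrising the derivative in w
  yields, up to -nu, the derivative in q. Differentiating the functional equation in w therefore
  speaks about Poisson brackets.\<close>

lemma rs_f_deriv_eq_ratio_deriv:
  assumes "exp (\<nu> * p) \<noteq> exp (\<nu> * q)"
  shows "rs_f_deriv \<nu> \<gamma> (p - q) = - \<nu> * (ratio_deriv (exp (2 * \<gamma>)) (exp (\<nu> * p)) (exp (\<nu> * q))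
    - ratio_deriv (exp (2 * \<gamma>)) (exp (\<nu> * q)) (exp (\<nu> * p)))"
proof -
  have "(a + 1 / a - 2) * (u / v) * (u / v + 1) / (u / v - 1) ^ 3 = - (ratio_deriv a u v - ratio_deriv a v u)"
    if "a \<noteq> 0" "v \<noteq> 0" "u \<noteq> v" for a u v :: complex
  proof -
    have "(u / v) * (u / v + 1) / (u / v - 1) ^ 3 = u * v * (u + v) / (u - v) ^ 3"
    proof -
      have "u / v + 1 = (u + v) / v" "u / v - 1 = (u - v) / v" using that by (simp_all add: field_simps)
      then show ?thesis using that by (simp add: power_divide power3_eq_cube)
    qed
    then have "(a + 1 / a - 2) * (u / v) * (u / v + 1) / (u / v - 1) ^ 3 = (a + 1 / a - 2) * u * v * (u + v) / (u - v) ^ 3"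
      by (simp add: mult.assoc flip: times_divide_eq_right)
    also have "\<dots> = - ((1 - 1 / a) * (u - a * v) * u * v + (1 - 1 / a) * (v - a * u) * v * u) / (u - v) ^ 3"
    proof -
      have "(a + 1 / a - 2) * u * v * (u + v) = - ((1 - 1 / a) * (u - a * v) * u * v + (1 - 1 / a) * (v - a * u) * v * u)"
        using that by (simp add: field_simps)
      then show ?thesis by simp
    qed
    also have "\<dots> = - (ratio_deriv a u v - ratio_deriv a v u)"
    proof -
      have "(v - u) ^ 3 = - ((u - v) ^ 3)" by (simp add: power3_eq_cube algebra_simps)
      then show ?thesis unfolding ratio_deriv_def by (simp add: add_divide_distrib diff_divide_distrib)
    qed
    finally show ?thesis .
  qed
  from this[of "exp (2 * \<gamma>)" "exp (\<nu> * q)" "exp (\<nu> * p)"] assms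
  have "(exp (2 * \<gamma>) + 1 / exp (2 * \<gamma>) - 2) * exp (\<nu> * (p - q)) * (exp (\<nu> * (p - q)) + 1)
      / (exp (\<nu> * (p - q)) - 1) ^ 3 = - (ratio_deriv (exp (2 * \<gamma>)) (exp (\<nu> * p)) (exp (\<nu> * q))
    - ratio_deriv (exp (2 * \<gamma>)) (exp (\<nu> * q)) (exp (\<nu> * p)))"
    by (simp only: right_diff_distrib exp_diff) simp
  from arg_cong[OF this, of "\<lambda>t. \<nu> * t"] show ?thesis
    unfolding rs_f_deriv_exp four_sinh_sq
    by (simp only: times_divide_eq_right mult.assoc mult_minus_left mult_minus_right)
qed

lemma rs_w_commute: "rs_w \<nu> \<gamma> x i k = rs_w \<nu> \<gamma> x k i"
  unfolding rs_w_def using rs_f_minus[of \<nu> \<gamma> "fst x $ i - fst x $ k"] by simp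

lemma rs_g_antisym: "rs_g \<nu> \<gamma> x i k = - rs_g \<nu> \<gamma> x k i"
  unfolding rs_g_def using rs_f_minus[of \<nu> \<gamma> "fst x $ i - fst x $ k"]
    rs_f_deriv_minus[of \<nu> \<gamma> "fst x $ i - fst x $ k"] by simp

section \<open>Symmetries of the data at points of the submanifold\<close>

lemma sigma_locusD:
  assumes "x \<in> sigma_locus \<beta> \<nu> \<sigma>" "\<beta> \<noteq> 0" "\<nu> \<noteq> 0"
  shows "exp (\<nu> * fst x $ i) * exp (\<nu> * fst x $ \<sigma> i) = 1"
    and "rs_y \<beta> x i * rs_y \<beta> x (\<sigma> i) = 1"
    and "\<sigma> i = i \<Longrightarrow> rs_y \<beta> x i = 1"
    and "\<sigma> i = i \<Longrightarrow> \<sigma> k = k \<Longrightarrow> i \<noteq> k \<Longrightarrow> exp (\<nu> * fst x $ i) = - exp (\<nu> * fst x $ k)"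
proof -
  \<comment> \<open>The period of the rapidities has the same shape as that of the positions, so
    \<open>congmod_rs_T_iff\<close> serves for both.\<close>
  have T: "2 * \<i> * of_real pi / \<beta> = rs_T \<beta>" by (simp add: rs_T_def)
  note mem = assms(1)[unfolded sigma_locus_def mem_Collect_eq case_prod_beta T
      congmod_rs_T_iff[OF assms(2)] congmod_rs_T_iff[OF assms(3)]]
  show "exp (\<nu> * fst x $ i) * exp (\<nu> * fst x $ \<sigma> i) = 1"
    using mem by (simp add: distrib_left exp_add)
  have "exp (\<beta> * snd x $ i) * exp (\<beta> * snd x $ \<sigma> i) = 1"
    using mem by (simp add: distrib_left exp_add)
  then show "rs_y \<beta> x i * rs_y \<beta> x (\<sigma> i) = 1"
    by (simp add: rs_y_def exp_minus field_simps)
  show "rs_y \<beta> x i = 1" if "\<sigma> i = i"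
    using mem that by (simp add: rs_y_def exp_minus)
  show "exp (\<nu> * fst x $ i) = - exp (\<nu> * fst x $ k)" if "\<sigma> i = i" "\<sigma> k = k" "i \<noteq> k"
  proof -
    have "\<forall>i j. \<sigma> i = i \<and> \<sigma> j = j \<and> i \<noteq> j \<longrightarrow>
        exp (\<nu> * fst x $ i) = 1 \<and> exp (\<nu> * fst x $ j) = -1 \<or>
        exp (\<nu> * fst x $ j) = 1 \<and> exp (\<nu> * fst x $ i) = -1"
      using mem unfolding exp_half_rs_T[OF assms(3)] by simp
    from this[rule_format, of i k] that show ?thesis by auto
  qed
qed

lemma reflected_weights_locus:
  fixes \<sigma> :: "'i::finite \<Rightarrow> 'i"
  assumes "x \<in> sigma_locus \<beta> \<nu> \<sigma>" "\<beta> \<noteq> 0" "\<nu> \<noteq> 0" "\<sigma> \<circ> \<sigma> = id" "pair_representatives \<sigma> R"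
  shows "reflected_weights \<sigma> (rs_y \<beta> x) (rs_w \<nu> \<gamma> x)"
proof
  note locus = sigma_locusD[OF assms(1-3)]
  have inv: "\<sigma> (\<sigma> i) = i" for i using assms(4) by (metis comp_apply id_apply)
  then show "\<sigma> (\<sigma> i) = i" for i .
  show "rs_y \<beta> x i * rs_y \<beta> x (\<sigma> i) = 1" for i by (rule locus)
  have R: "R \<inter> \<sigma> ` R = {}" "R \<union> \<sigma> ` R = {i. \<sigma> i \<noteq> i}"
    using assms(5) by (auto simp: pair_representatives_def)
  \<comment> \<open>Fixed indices contribute 1, and the remaining factors cancel within their
    pairs.\<close>
  have "(\<Prod>i\<in>UNIV. rs_y \<beta> x i) = (\<Prod>i\<in>R \<union> \<sigma> ` R. rs_y \<beta> x i)"
    by (rule prod.mono_neutral_right) (auto simp: R(2) locus(3))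
  also have "\<dots> = (\<Prod>i\<in>R. rs_y \<beta> x i) * (\<Prod>i\<in>\<sigma> ` R. rs_y \<beta> x i)"
    by (rule prod.union_disjoint) (use R(1) in auto)
  also have "(\<Prod>i\<in>\<sigma> ` R. rs_y \<beta> x i) = (\<Prod>i\<in>R. rs_y \<beta> x (\<sigma> i))"
    by (rule prod.reindex[unfolded comp_def]) (metis inj_onI inv)
  finally show "(\<Prod>i\<in>UNIV. rs_y \<beta> x i) = 1"
    by (simp add: locus(2) flip: prod.distrib)
  show "rs_w \<nu> \<gamma> x i k = rs_w \<nu> \<gamma> x k i" for i k by (rule rs_w_commute)
  \<comment> \<open>Modulo T the reflection reverses differences of positions, and \<open>f\<close>
    is even and T-periodic.\<close>
  have "exp (\<nu> * (fst x $ \<sigma> i - fst x $ \<sigma> k)) = exp (\<nu> * (fst x $ k - fst x $ i))" for i k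
    using locus(1)[of i] locus(1)[of k] by (simp add: right_diff_distrib exp_diff field_simps)
  then show "rs_w \<nu> \<gamma> x (\<sigma> i) (\<sigma> k) = rs_w \<nu> \<gamma> x i k" for i k
    unfolding rs_w_commute[of \<nu> \<gamma> x i k] unfolding rs_w_def by (metis rs_f_cong(1))
qed

lemma reflected_forces_submanifold:
  fixes \<sigma> :: "'i::finite \<Rightarrow> 'i"
  assumes "x \<in> sigma_submanifold \<beta> \<nu> \<gamma> \<sigma>" "\<beta> \<noteq> 0" "\<nu> \<noteq> 0" "\<sigma> \<circ> \<sigma> = id" "pair_representatives \<sigma> R"
  shows "reflected_forces \<sigma> (rs_y \<beta> x) (rs_w \<nu> \<gamma> x) (rs_g \<nu> \<gamma> x)"
proof -
  have x: "x \<in> sigma_locus \<beta> \<nu> \<sigma>"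
    using assms(1) by (simp add: sigma_submanifold_def)
  note locus = sigma_locusD[OF x assms(2,3)]
  interpret reflected_weights \<sigma> "rs_y \<beta> x" "rs_w \<nu> \<gamma> x"
    by (rule reflected_weights_locus[OF x assms(2-)])
  let ?Z = "\<lambda>i. exp (\<nu> * fst x $ i)" and ?a = "exp (2 * \<gamma>)"
  have dist: "?Z i \<noteq> ?Z k" if "i \<noteq> k" for i k
    using assms(1) that by (simp add: sigma_submanifold_def congmod_rs_T_iff[OF assms(3)])
  have f0: "\<sigma> i = i \<and> \<sigma> k = k" if "i \<noteq> k" "rs_f \<nu> \<gamma> (fst x $ i - fst x $ k) = 0" for i k
    using assms(1) that by (force simp: sigma_submanifold_def)
  show ?thesis
  proof
    show "rs_g \<nu> \<gamma> x i k = - rs_g \<nu> \<gamma> x k i" for i k by (rule rs_g_antisym)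
    have e: "exp (\<nu> * (fst x $ \<sigma> i - fst x $ \<sigma> k)) = exp (\<nu> * (fst x $ k - fst x $ i))" for i k
      using locus(1)[of i] locus(1)[of k] by (simp add: right_diff_distrib exp_diff field_simps)
    show "rs_g \<nu> \<gamma> x (\<sigma> i) (\<sigma> k) = - rs_g \<nu> \<gamma> x i k" for i k
      unfolding rs_g_antisym[of \<nu> \<gamma> x i k] minus_minus
      unfolding rs_g_def rs_f_cong[OF e] ..
    fix E :: "'i set" and p :: nat
    define \<psi> where "\<psi> i k = ratio_deriv ?a (?Z i) (?Z k) / ratio ?a (1 / ?a) (?Z i) (?Z k)" for i k
    have fr: "(rs_w \<nu> \<gamma> x i k)\<^sup>2 = ratio ?a (1 / ?a) (?Z i) (?Z k)" if "i \<noteq> k" for i k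
      using rs_f_eq_ratio[OF dist[OF that], of \<gamma>] by (simp add: rs_w_def)
    have psi: "ratio_deriv ?a (?Z i) (?Z k) = ratio ?a (1 / ?a) (?Z i) (?Z k) * \<psi> i k" if "i \<noteq> k" for i k
    proof (cases "ratio ?a (1 / ?a) (?Z i) (?Z k) = 0")
      \<comment> \<open>A zero forces both indices to be fixed, where the points are opposite.
        Together with either vanishing factor this means a = -1, so the numerator factor u - a v of
        \<open>ratio_deriv\<close> vanishes as well, whatever the value of
        \<open>\<psi>\<close>.\<close>
      case True
      then have "\<sigma> i = i" "\<sigma> k = k"
        using f0[OF that] rs_f_eq_ratio[OF dist[OF that], of \<gamma>] by auto
      then have "?Z i = - ?Z k" using locus(4) that by blast
      have "?Z i - ?a * ?Z k = 0 \<or> ?Z i - 1 / ?a * ?Z k = 0"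
        using True dist[OF that] by (simp add: ratio_def)
      then have "?Z i = ?a * ?Z k"
      proof
        assume "?Z i - 1 / ?a * ?Z k = 0"
        then have "?a * ?Z i = ?Z k" by (simp add: field_simps)
        with \<open>?Z i = - ?Z k\<close> show ?thesis by (metis minus_minus mult_minus_right)
      qed simp
      then have "ratio_deriv ?a (?Z i) (?Z k) = 0" by (simp add: ratio_deriv_def)
      then show ?thesis using True by simp
    qed (simp add: \<psi>_def)
    have g: "rs_g \<nu> \<gamma> x i k = - \<nu> / 2 * (\<psi> i k - \<psi> k i)" if "i \<noteq> k" for i k
    proof -
      have "ratio ?a (1 / ?a) (?Z k) (?Z i) = ratio ?a (1 / ?a) (?Z i) (?Z k)"
        using ratio_reflect[of ?a "1 / ?a" "?Z i" "?Z k"] by simp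
      then show ?thesis
        unfolding rs_g_def \<psi>_def rs_f_deriv_eq_ratio_deriv[OF dist[OF that]] rs_f_eq_ratio[OF dist[OF that]]
        by (simp add: diff_divide_distrib right_diff_distrib)
    qed
    have "(\<Sum>B | B \<subseteq> E \<and> card B = p. cross (\<lambda>i k. ratio ?a (1 / ?a) (?Z i) (?Z k)) B (E - B) *
           (\<Sum>b\<in>B. \<Sum>c\<in>E - B. \<psi> b c - \<psi> c b)) = 0"
      by (rule functional_equation) (use dist psi in \<open>auto intro!: inj_onI\<close>)
    moreover have "(\<Sum>B | B \<subseteq> E \<and> card B = p. cross (\<lambda>i k. (rs_w \<nu> \<gamma> x i k)\<^sup>2) B (E - B) *
           (\<Sum>b\<in>B. \<Sum>c\<in>E - B. rs_g \<nu> \<gamma> x b c))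
      = (\<Sum>B | B \<subseteq> E \<and> card B = p. - \<nu> / 2 * (cross (\<lambda>i k. ratio ?a (1 / ?a) (?Z i) (?Z k)) B (E - B) *
           (\<Sum>b\<in>B. \<Sum>c\<in>E - B. \<psi> b c - \<psi> c b)))"
    proof (intro sum.cong refl)
      fix B
      have "cross (\<lambda>i k. (rs_w \<nu> \<gamma> x i k)\<^sup>2) B (E - B) = cross (\<lambda>i k. ratio ?a (1 / ?a) (?Z i) (?Z k)) B (E - B)"
        unfolding cross_def by (intro prod.cong refl fr) auto
      moreover have "(\<Sum>b\<in>B. \<Sum>c\<in>E - B. rs_g \<nu> \<gamma> x b c) = (\<Sum>b\<in>B. \<Sum>c\<in>E - B. - \<nu> / 2 * (\<psi> b c - \<psi> c b))"
        by (intro sum.cong refl g) auto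
      ultimately show "cross (\<lambda>i k. (rs_w \<nu> \<gamma> x i k)\<^sup>2) B (E - B) * (\<Sum>b\<in>B. \<Sum>c\<in>E - B. rs_g \<nu> \<gamma> x b c)
        = - \<nu> / 2 * (cross (\<lambda>i k. ratio ?a (1 / ?a) (?Z i) (?Z k)) B (E - B) *
           (\<Sum>b\<in>B. \<Sum>c\<in>E - B. \<psi> b c - \<psi> c b))"
        by (simp only: sum_distrib_left mult.left_commute)
    qed
    ultimately show "(\<Sum>B | B \<subseteq> E \<and> card B = p. cross (\<lambda>i k. (rs_w \<nu> \<gamma> x i k)\<^sup>2) B (E - B) *
           (\<Sum>b\<in>B. \<Sum>c\<in>E - B. rs_g \<nu> \<gamma> x b c)) = 0"
      by (simp only: sum_distrib_left[symmetric] mult_zero_right)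
  qed
qed

text \<open>Stated on the whole locus because the coordinate shifts stay there for every s: the two
  functions agree along the entire line, hence so do their derivatives, although they differ off the
  locus in general.\<close>

lemma rs_H_eq_rs_h:
  fixes \<sigma> :: "'i::finite \<Rightarrow> 'i"
  assumes "x \<in> sigma_locus \<beta> \<nu> \<sigma>" "\<beta> \<noteq> 0" "\<nu> \<noteq> 0" "\<sigma> \<circ> \<sigma> = id" "pair_representatives \<sigma> R"
    and "l \<le> CARD('i)"
  shows "rs_H \<beta> \<nu> \<gamma> l x = rs_h \<beta> \<nu> \<gamma> l x"
proof -
  interpret reflected_weights \<sigma> "rs_y \<beta> x" "rs_w \<nu> \<gamma> x"
    by (rule reflected_weights_locus[OF assms(1-5)])
  have "{I :: 'i set. card I = CARD('i)} = {UNIV}"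
    using card_subset_eq[OF finite subset_UNIV] by auto
  then have top: "rs_h \<beta> \<nu> \<gamma> CARD('i) x = 1"
    unfolding rs_h_eq_sum_weight by (simp add: weight_def prod_y cross_def)
  have bot: "rs_h \<beta> \<nu> \<gamma> 0 x = 1"
  proof -
    have "{I :: 'i set. card I = 0} = {{}}" by auto
    then show ?thesis unfolding rs_h_eq_sum_weight by (simp add: weight_def cross_def)
  qed
  show ?thesis
  proof (cases "l = 0")
    \<comment> \<open>Both sides are 1: K_0 is built from h_(n+1) = 1, while \<open>rs_h\<close> at
      0 consists of the empty set's summand.\<close>
    case True
    then show ?thesis by (simp add: rs_H_def rs_K_def top bot)
  next
    case False
    then show ?thesis
      using sum_weight_complementary[OF assms(6)]
      by (simp add: rs_H_def rs_K_def top rs_h_eq_sum_weight[of \<beta> \<nu> \<gamma> l]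
          rs_h_eq_sum_weight[of \<beta> \<nu> \<gamma> "CARD('i) - l"])
  qed
qed

text \<open>If both positions move equally, the difference is constant and the root may sit on its
  cut or at a zero; this admits the pair of fixed indices. Otherwise the chain rule applies off the
  cut.\<close>

lemma rs_w_shift_has_field_derivative:
  assumes "d i = d k \<or> (\<not> congmod (rs_T \<nu>) (fst x $ i) (fst x $ k) \<and>
      rs_f \<nu> \<gamma> (fst x $ i - fst x $ k) \<notin> \<real>\<^sub>\<le>\<^sub>0)"
    and "\<nu> \<noteq> 0" and v: "\<And>s j. v s $ j = s * d j"
  shows "((\<lambda>s. rs_w \<nu> \<gamma> (fst x + v s, snd x) i k) has_field_derivative
     rs_w \<nu> \<gamma> (fst x + v 0, snd x) i k * (rs_g \<nu> \<gamma> x i k * (d i - d k))) (at 0)"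
proof (cases "d i = d k")
  case True
  then show ?thesis by (simp add: rs_w_def v)
next
  case False
  let ?q = "fst x $ i - fst x $ k"
  have nr: "rs_f \<nu> \<gamma> ?q \<notin> \<real>\<^sub>\<le>\<^sub>0" and sh: "sinh (\<nu> * ?q / 2) \<noteq> 0"
    using assms(1) False sinh_eq_0_iff_congmod[OF assms(2), of "fst x $ i" "fst x $ k"] by auto
  have nz: "rs_f \<nu> \<gamma> ?q \<noteq> 0" using nr by auto
  have lin: "((\<lambda>s. ?q + s * (d i - d k)) has_field_derivative (d i - d k)) (at 0)"
    by (rule derivative_eq_intros refl | simp)+
  have "(rs_f \<nu> \<gamma> has_field_derivative rs_f_deriv \<nu> \<gamma> (?q + 0 * (d i - d k))) (at (?q + 0 * (d i - d k)))"
    using rs_f_has_field_derivative[OF sh] by simp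
  from DERIV_chain2[OF this lin]
  have f: "((\<lambda>s. rs_f \<nu> \<gamma> (?q + s * (d i - d k))) has_field_derivative rs_f_deriv \<nu> \<gamma> ?q * (d i - d k)) (at 0)"
    by simp
  have "(csqrt has_field_derivative inverse (2 * csqrt (rs_f \<nu> \<gamma> ?q))) (at (rs_f \<nu> \<gamma> (?q + 0 * (d i - d k))))"
    using has_field_derivative_csqrt[OF nr] by simp
  from DERIV_chain2[OF this f]
  have D: "((\<lambda>s. csqrt (rs_f \<nu> \<gamma> (?q + s * (d i - d k)))) has_field_derivative
      inverse (2 * csqrt (rs_f \<nu> \<gamma> ?q)) * (rs_f_deriv \<nu> \<gamma> ?q * (d i - d k))) (at 0)" .
  have val: "inverse (2 * csqrt (rs_f \<nu> \<gamma> ?q)) * (rs_f_deriv \<nu> \<gamma> ?q * (d i - d k)) =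
      csqrt (rs_f \<nu> \<gamma> ?q) * (rs_f_deriv \<nu> \<gamma> ?q / (2 * rs_f \<nu> \<gamma> ?q) * (d i - d k))"
  proof -
    have "inverse (2 * c) * t = c * (u / (2 * z) * e)" if "c * c = z" "z \<noteq> 0" "t = u * e" for c t u z e :: complex
      using that by (auto simp: field_simps)
    from this[OF _ nz refl] show ?thesis
      by (metis power2_csqrt power2_eq_square)
  qed
  have e: "fst x $ i + s * d i - (fst x $ k + s * d k) = ?q + s * (d i - d k)" for s
    by (simp add: algebra_simps)
  show ?thesis
    unfolding rs_w_def rs_g_def fst_conv vector_add_component v e
    using D unfolding val by simp
qed

lemma sum_sum_difference_eq_opposite_sum:
  fixes d :: "'i::finite \<Rightarrow> complex"
  assumes anti: "\<And>i k. g i k = - g k i"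
  shows "(\<Sum>b\<in>I. \<Sum>c\<in>- I. g b c * (d b - d c)) = (\<Sum>j\<in>UNIV. d j * opposite_sum g j I)"
proof -
  have "(\<Sum>j\<in>UNIV. d j * opposite_sum g j I)
      = (\<Sum>j\<in>I. d j * opposite_sum g j I) + (\<Sum>j\<in>- I. d j * opposite_sum g j I)"
    by (subst sum.union_disjoint[symmetric]) auto
  also have "(\<Sum>j\<in>I. d j * opposite_sum g j I) = (\<Sum>b\<in>I. \<Sum>c\<in>- I. g b c * d b)"
    by (intro sum.cong) (auto simp: opposite_sum_def sum_distrib_left mult.commute)
  also have "(\<Sum>j\<in>- I. d j * opposite_sum g j I) = (\<Sum>c\<in>- I. \<Sum>b\<in>I. g c b * d c)"
    by (intro sum.cong) (auto simp: opposite_sum_def sum_distrib_left mult.commute)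
  also have "\<dots> = (\<Sum>b\<in>I. \<Sum>c\<in>- I. - g b c * d c)"
    by (subst sum.swap, subst anti) simp
  finally show ?thesis
    by (simp add: algebra_simps sum_subtractf sum_negf)
qed

lemma rs_h_has_field_derivative_Q:
  fixes d :: "'i::finite \<Rightarrow> complex"
  assumes "\<And>i k. d i \<noteq> d k \<Longrightarrow> \<not> congmod (rs_T \<nu>) (fst x $ i) (fst x $ k) \<and>
      rs_f \<nu> \<gamma> (fst x $ i - fst x $ k) \<notin> \<real>\<^sub>\<le>\<^sub>0"
    and "\<nu> \<noteq> 0" and v: "\<And>s j. v s $ j = s * d j"
  shows "((\<lambda>s. rs_h \<beta> \<nu> \<gamma> l (fst x + v s, snd x)) has_field_derivative
     (\<Sum>j\<in>UNIV. d j * force_sum (rs_y \<beta> x) (rs_w \<nu> \<gamma> x) (rs_g \<nu> \<gamma> x) l j)) (at 0)"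
proof -
  let ?x = "\<lambda>s. (fst x + v s, snd x)"
  have v0: "v 0 = 0" using v by (simp add: Finite_Cartesian_Product.vec_eq_iff)
  have y: "rs_y \<beta> (?x s) = rs_y \<beta> x" for s by (simp add: rs_y_def fun_eq_iff)
  have "((\<lambda>s. rs_h \<beta> \<nu> \<gamma> l (?x s)) has_field_derivative
     (\<Sum>I | card I = l. (\<Prod>i\<in>I. rs_y \<beta> x i) * (cross (rs_w \<nu> \<gamma> (?x 0)) I (- I) *
        (\<Sum>b\<in>I. \<Sum>c\<in>- I. rs_g \<nu> \<gamma> x b c * (d b - d c))))) (at 0)"
    unfolding rs_h_eq_sum_weight weight_def y
    by (intro DERIV_sum DERIV_cmult cross_has_field_derivative rs_w_shift_has_field_derivative)
       (use assms in auto)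
  also have "(\<Sum>I | card I = l. (\<Prod>i\<in>I. rs_y \<beta> x i) * (cross (rs_w \<nu> \<gamma> (?x 0)) I (- I) *
        (\<Sum>b\<in>I. \<Sum>c\<in>- I. rs_g \<nu> \<gamma> x b c * (d b - d c))))
    = (\<Sum>I | card I = l. \<Sum>j\<in>UNIV. d j * (weight (rs_y \<beta> x) (rs_w \<nu> \<gamma> x) I * opposite_sum (rs_g \<nu> \<gamma> x) j I))"
    unfolding sum_sum_difference_eq_opposite_sum[of "rs_g \<nu> \<gamma> x", OF rs_g_antisym] weight_def
    by (simp add: v0 sum_distrib_left mult_ac)
  also have "\<dots> = (\<Sum>j\<in>UNIV. d j * force_sum (rs_y \<beta> x) (rs_w \<nu> \<gamma> x) (rs_g \<nu> \<gamma> x) l j)"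
    unfolding force_sum_def sum_distrib_left by (rule sum.swap)
  finally show ?thesis .
qed

lemma rs_h_has_field_derivative_P:
  fixes d :: "'i::finite \<Rightarrow> complex"
  assumes v: "\<And>s j. v s $ j = s * d j"
  shows "((\<lambda>s. rs_h \<beta> \<nu> \<gamma> l (fst x, snd x + v s)) has_field_derivative
     - \<beta> * (\<Sum>j\<in>UNIV. d j * occupation_sum (rs_y \<beta> x) (rs_w \<nu> \<gamma> x) l j)) (at 0)"
proof -
  let ?x = "\<lambda>s. (fst x, snd x + v s)"
  have v0: "v 0 = 0" using v by (simp add: Finite_Cartesian_Product.vec_eq_iff)
  have w: "rs_w \<nu> \<gamma> (?x s) = rs_w \<nu> \<gamma> x" for s by (simp add: rs_w_def fun_eq_iff)
  have "((\<lambda>s. rs_y \<beta> (?x s) i) has_field_derivative rs_y \<beta> (?x 0) i * (- \<beta> * d i)) (at 0)" for i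
    unfolding rs_y_def snd_conv vector_add_component v
    by (rule derivative_eq_intros refl | simp)+
  then have "((\<lambda>s. rs_h \<beta> \<nu> \<gamma> l (?x s)) has_field_derivative
     (\<Sum>I | card I = l. ((\<Prod>i\<in>I. rs_y \<beta> (?x 0) i) * (\<Sum>i\<in>I. - \<beta> * d i)) * cross (rs_w \<nu> \<gamma> x) I (- I))) (at 0)"
    unfolding rs_h_eq_sum_weight weight_def w
    by (intro DERIV_sum DERIV_cmult_right has_field_derivative_prod_log) auto
  also have "(\<Sum>I | card I = l. ((\<Prod>i\<in>I. rs_y \<beta> (?x 0) i) * (\<Sum>i\<in>I. - \<beta> * d i)) * cross (rs_w \<nu> \<gamma> x) I (- I))
    = (\<Sum>I | card I = l. \<Sum>j\<in>UNIV. - \<beta> * (d j * (weight (rs_y \<beta> x) (rs_w \<nu> \<gamma> x) I * of_bool (j \<in> I))))"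
  proof (intro sum.cong refl)
    fix I :: "'i set"
    have "(\<Sum>i\<in>I. - \<beta> * d i) = (\<Sum>i\<in>UNIV. - \<beta> * (d i * of_bool (i \<in> I)))"
      by (rule sum.mono_neutral_cong_left) auto
    then show "((\<Prod>i\<in>I. rs_y \<beta> (?x 0) i) * (\<Sum>i\<in>I. - \<beta> * d i)) * cross (rs_w \<nu> \<gamma> x) I (- I)
      = (\<Sum>j\<in>UNIV. - \<beta> * (d j * (weight (rs_y \<beta> x) (rs_w \<nu> \<gamma> x) I * of_bool (j \<in> I))))"
      by (simp only: v0 add_0_right prod.collapse weight_def sum_distrib_left sum_distrib_right mult_ac)
  qed
  also have "\<dots> = - \<beta> * (\<Sum>j\<in>UNIV. d j * occupation_sum (rs_y \<beta> x) (rs_w \<nu> \<gamma> x) l j)"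
    unfolding occupation_sum_def sum_distrib_left by (rule sum.swap)
  finally show ?thesis .
qed

lemma rest_shift_component:
  assumes "\<sigma> i \<noteq> i"
  shows "rest_shift \<sigma> i s $ j = s * ((of_bool (j = i) - of_bool (j = \<sigma> i)) / of_real (sqrt 2))"
  using assms by (simp add: rest_shift_def)

lemma sum_rest_direction:
  fixes h :: "'i::finite \<Rightarrow> complex"
  shows "(\<Sum>j\<in>UNIV. (of_bool (j = i) - of_bool (j = k)) / of_real (sqrt 2) * h j) = (h i - h k) / of_real (sqrt 2)"
proof -
  have "(\<Sum>j\<in>UNIV. (of_bool (j = i) - of_bool (j = k)) * h j) = h i - h k"
    by (simp add: left_diff_distrib sum_subtractf of_bool_def if_distrib[of "\<lambda>t. t * _"] cong: if_cong)
  then show ?thesis by (simp flip: sum_divide_distrib)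
qed

section \<open>Coordinate derivatives on the submanifold and involution\<close>

context
  fixes \<beta> \<nu> \<gamma> :: complex and \<sigma> :: "'i::finite \<Rightarrow> 'i" and R :: "'i set"
  assumes nz: "\<beta> \<noteq> 0" "\<nu> \<noteq> 0" and inv: "\<sigma> \<circ> \<sigma> = id" and reps: "pair_representatives \<sigma> R"
begin

lemma submanifold_locus: "x \<in> sigma_submanifold \<beta> \<nu> \<gamma> \<sigma> \<Longrightarrow> x \<in> sigma_locus \<beta> \<nu> \<sigma>"
  by (simp add: sigma_submanifold_def)

lemma moved: "i \<in> R \<Longrightarrow> \<sigma> i \<noteq> i"
  using reps by (auto simp: pair_representatives_def)

lemma shift_Q_in_locus:
  assumes "x \<in> sigma_locus \<beta> \<nu> \<sigma>" "i \<in> R"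
  shows "(fst x + rest_shift \<sigma> i s, snd x) \<in> sigma_locus \<beta> \<nu> \<sigma>"
proof -
  have "rest_shift \<sigma> i 0 = 0" by (simp add: rest_shift_def Finite_Cartesian_Product.vec_eq_iff)
  then show ?thesis using rest_shift_in_locus[OF inv moved[OF assms(2)] assms(1), of s 0] by simp
qed

lemma shift_P_in_locus:
  assumes "x \<in> sigma_locus \<beta> \<nu> \<sigma>" "i \<in> R"
  shows "(fst x, snd x + rest_shift \<sigma> i s) \<in> sigma_locus \<beta> \<nu> \<sigma>"
proof -
  have "rest_shift \<sigma> i 0 = 0" by (simp add: rest_shift_def Finite_Cartesian_Product.vec_eq_iff)
  then show ?thesis using rest_shift_in_locus[OF inv moved[OF assms(2)] assms(1), of 0 s] by simp
qed

lemma dQ_rs_H: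
  assumes x: "x \<in> sigma_submanifold \<beta> \<nu> \<gamma> \<sigma>" and i: "i \<in> R" and l: "l \<le> CARD('i)"
  shows "dQ \<sigma> i (rs_H \<beta> \<nu> \<gamma> l) x
    = (force_sum (rs_y \<beta> x) (rs_w \<nu> \<gamma> x) (rs_g \<nu> \<gamma> x) l i
      - force_sum (rs_y \<beta> x) (rs_w \<nu> \<gamma> x) (rs_g \<nu> \<gamma> x) l (\<sigma> i)) / of_real (sqrt 2)"
proof -
  define d :: "'i \<Rightarrow> complex" where "d j = (of_bool (j = i) - of_bool (j = \<sigma> i)) / of_real (sqrt 2)" for j
  have eq: "rs_H \<beta> \<nu> \<gamma> l (fst x + rest_shift \<sigma> i s, snd x) = rs_h \<beta> \<nu> \<gamma> l (fst x + rest_shift \<sigma> i s, snd x)" for s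
    by (rule rs_H_eq_rs_h[OF shift_Q_in_locus[OF submanifold_locus[OF x] i] nz inv reps l])
  \<comment> \<open>A difference that changes along the shift involves i or its reflection. Neither
    is fixed, so the regularity conditions of the submanifold cover this pair.\<close>
  have reg: "\<not> congmod (rs_T \<nu>) (fst x $ j) (fst x $ k) \<and> rs_f \<nu> \<gamma> (fst x $ j - fst x $ k) \<notin> \<real>\<^sub>\<le>\<^sub>0"
    if "d j \<noteq> d k" for j k
  proof -
    have ne: "j \<noteq> k" using that by auto
    have "j = i \<or> j = \<sigma> i \<or> k = i \<or> k = \<sigma> i"
      using that by (auto simp: d_def)
    moreover have "\<sigma> (\<sigma> i) \<noteq> \<sigma> i"
      using moved[OF i] inv by (metis comp_apply id_apply)
    ultimately have "\<not> (\<sigma> j = j \<and> \<sigma> k = k)" using moved[OF i] by auto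
    then show ?thesis using x ne by (simp add: sigma_submanifold_def)
  qed
  have "((\<lambda>s. rs_h \<beta> \<nu> \<gamma> l (fst x + rest_shift \<sigma> i s, snd x)) has_field_derivative
     (\<Sum>j\<in>UNIV. d j * force_sum (rs_y \<beta> x) (rs_w \<nu> \<gamma> x) (rs_g \<nu> \<gamma> x) l j)) (at 0)"
    by (rule rs_h_has_field_derivative_Q) (use reg nz moved[OF i] in \<open>auto simp: rest_shift_component d_def\<close>)
  from DERIV_imp_deriv[OF this] show ?thesis
    unfolding dQ_def eq unfolding d_def sum_rest_direction .
qed

lemma dP_rs_H:
  assumes x: "x \<in> sigma_locus \<beta> \<nu> \<sigma>" and i: "i \<in> R" and l: "l \<le> CARD('i)"
  shows "dP \<sigma> i (rs_H \<beta> \<nu> \<gamma> l) x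
    = - \<beta> * ((occupation_sum (rs_y \<beta> x) (rs_w \<nu> \<gamma> x) l i
      - occupation_sum (rs_y \<beta> x) (rs_w \<nu> \<gamma> x) l (\<sigma> i)) / of_real (sqrt 2))"
proof -
  define d :: "'i \<Rightarrow> complex" where "d j = (of_bool (j = i) - of_bool (j = \<sigma> i)) / of_real (sqrt 2)" for j
  have eq: "rs_H \<beta> \<nu> \<gamma> l (fst x, snd x + rest_shift \<sigma> i s) = rs_h \<beta> \<nu> \<gamma> l (fst x, snd x + rest_shift \<sigma> i s)" for s
    by (rule rs_H_eq_rs_h[OF shift_P_in_locus[OF x i] nz inv reps l])
  have "((\<lambda>s. rs_h \<beta> \<nu> \<gamma> l (fst x, snd x + rest_shift \<sigma> i s)) has_field_derivative
     - \<beta> * (\<Sum>j\<in>UNIV. d j * occupation_sum (rs_y \<beta> x) (rs_w \<nu> \<gamma> x) l j)) (at 0)"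
    by (rule rs_h_has_field_derivative_P) (use moved[OF i] in \<open>auto simp: rest_shift_component d_def\<close>)
  from DERIV_imp_deriv[OF this] show ?thesis
    unfolding dP_def eq unfolding d_def sum_rest_direction .
qed

theorem rest_bracket_rs_H_eq_0:
  assumes x: "x \<in> sigma_submanifold \<beta> \<nu> \<gamma> \<sigma>" and kl: "k \<le> CARD('i)" "l \<le> CARD('i)"
  shows "rest_bracket \<sigma> R (rs_H \<beta> \<nu> \<gamma> k) (rs_H \<beta> \<nu> \<gamma> l) x = 0"
proof -
  interpret reflected_forces \<sigma> "rs_y \<beta> x" "rs_w \<nu> \<gamma> x" "rs_g \<nu> \<gamma> x"
    by (rule reflected_forces_submanifold[OF x nz inv reps])
  let ?t = "occupation_sum (rs_y \<beta> x) (rs_w \<nu> \<gamma> x)" and ?q = "force_sum (rs_y \<beta> x) (rs_w \<nu> \<gamma> x) (rs_g \<nu> \<gamma> x)"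
  \<comment> \<open>Each derivative carries 1 / sqrt 2 and each rapidity derivative a further
    -beta.\<close>
  have "rest_bracket \<sigma> R (rs_H \<beta> \<nu> \<gamma> k) (rs_H \<beta> \<nu> \<gamma> l) x
      = (\<Sum>i\<in>R. - \<beta> / (of_real (sqrt 2) * of_real (sqrt 2)) * ((?t k i - ?t k (\<sigma> i)) * (?q l i - ?q l (\<sigma> i))
                - (?q k i - ?q k (\<sigma> i)) * (?t l i - ?t l (\<sigma> i))))"
    unfolding rest_bracket_def
  proof (intro sum.cong refl)
    fix i assume i: "i \<in> R"
    show "dP \<sigma> i (rs_H \<beta> \<nu> \<gamma> k) x * dQ \<sigma> i (rs_H \<beta> \<nu> \<gamma> l) x - dQ \<sigma> i (rs_H \<beta> \<nu> \<gamma> k) x * dP \<sigma> i (rs_H \<beta> \<nu> \<gamma> l) x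
      = - \<beta> / (of_real (sqrt 2) * of_real (sqrt 2)) * ((?t k i - ?t k (\<sigma> i)) * (?q l i - ?q l (\<sigma> i))
                - (?q k i - ?q k (\<sigma> i)) * (?t l i - ?t l (\<sigma> i)))"
      unfolding dQ_rs_H[OF x i kl(1)] dQ_rs_H[OF x i kl(2)]
        dP_rs_H[OF submanifold_locus[OF x] i kl(1)] dP_rs_H[OF submanifold_locus[OF x] i kl(2)]
      by (simp add: field_simps)
  qed
  also have "\<dots> = 0"
    unfolding sum_distrib_left[symmetric]
    using rest_bracket_weights_eq_0[OF _ _ kl, of R] reps by (simp add: pair_representatives_def)
  finally show ?thesis .
qed

end

section \<open>Determinants and dominant exponentials\<close>

text \<open>The determinant as an explicit sum of products of its entries, so that limits,
  continuity and holomorphy follow entrywise.\<close>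

definition leibniz :: "nat \<Rightarrow> (nat \<Rightarrow> nat \<Rightarrow> complex) \<Rightarrow> complex" where
  "leibniz m f = (\<Sum>p | p permutes {0..<m}. signof p * (\<Prod>i = 0..<m. f i (p i)))"

lemma leibniz_eq_det: "leibniz m f = Determinant.det (Matrix.mat m m (\<lambda>(i, j). f i j))"
  unfolding leibniz_def
proof (subst det_def'[of _ m], simp, intro sum.cong refl)
  fix p assume "p \<in> {p. p permutes {0..<m}}"
  then have "p i < m" if "i < m" for i
    using that permutes_in_image[of p "{0..<m}" i] by auto
  then show "signof p * (\<Prod>i = 0..<m. f i (p i)) =
      signof p * (\<Prod>i = 0..<m. Matrix.mat m m (\<lambda>(i, j). f i j) $$ (i, p i))"
    by simp
qed

lemma leibniz_upper_triangular:
  assumes "\<And>i j. j < i \<Longrightarrow> i < m \<Longrightarrow> f i j = 0"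
  shows "leibniz m f = (\<Prod>i<m. f i i)"
proof -
  let ?A = "Matrix.mat m m (\<lambda>(i, j). f i j)"
  have "upper_triangular ?A"
    using assms by (auto simp: upper_triangular_def)
  then have "Determinant.det ?A = prod_list (diag_mat ?A)"
    by (rule det_upper_triangular[of _ m]) simp
  also have "\<dots> = (\<Prod>i<m. f i i)"
    by (simp add: prod_list_diag_prod atLeast0LessThan)
  finally show ?thesis by (simp add: leibniz_eq_det)
qed

lemma leibniz_nonzero_kernel:
  assumes "leibniz m f \<noteq> 0" "\<And>i. i < m \<Longrightarrow> (\<Sum>j<m. f i j * c j) = 0" "j < m"
  shows "c j = 0"
proof (rule ccontr)
  assume "c j \<noteq> 0"
  let ?A = "Matrix.mat m m (\<lambda>(i, j). f i j)" and ?c = "Matrix.vec m c"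
  have "?c \<noteq> 0\<^sub>v m"
    using \<open>c j \<noteq> 0\<close> assms(3) by (metis index_vec index_zero_vec(1))
  moreover have "?A *\<^sub>v ?c = 0\<^sub>v m"
    using assms(2) by (intro eq_vecI) (simp_all add: scalar_prod_def atLeast0LessThan)
  ultimately have "Determinant.det ?A = 0"
    using det_0_iff_vec_prod_zero[of ?A m] by (metis mat_carrier vec_carrier)
  then show False using assms(1) by (simp add: leibniz_eq_det)
qed

text \<open>Every permutation uses each column exactly once. This permits dividing each column by
  its own dominant exponential.\<close>

lemma leibniz_scale_columns: "leibniz m (\<lambda>i j. f i j * k j) = leibniz m f * (\<Prod>j<m. k j)"
  unfolding leibniz_def sum_distrib_right
proof (intro sum.cong refl)
  fix p assume "p \<in> {p. p permutes {0..<m}}"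
  then have "(\<Prod>i = 0..<m. k (p i)) = (\<Prod>j<m. k j)"
    using prod.permute[of p "{0..<m}" k] by (simp add: atLeast0LessThan o_def)
  then show "signof p * (\<Prod>i = 0..<m. f i (p i) * k (p i)) =
      signof p * (\<Prod>i = 0..<m. f i (p i)) * (\<Prod>j<m. k j)"
    by (simp add: prod.distrib)
qed

lemma tendsto_dominant_exponential:
  fixes a :: "'a \<Rightarrow> complex" and \<delta> :: "'a \<Rightarrow> real"
  assumes "finite \<I>" "J \<in> \<I>" "\<And>I. I \<in> \<I> \<Longrightarrow> I \<noteq> J \<Longrightarrow> \<delta> I < \<delta> J"
  shows "((\<lambda>s. \<Sum>I\<in>\<I>. a I * exp (of_real (s * (\<delta> I - \<delta> J)))) \<longlongrightarrow> a J) at_top"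
proof -
  have "((\<lambda>s. a I * exp (of_real (s * (\<delta> I - \<delta> J)))) \<longlongrightarrow> (if I = J then a J else 0)) at_top"
    if "I \<in> \<I>" for I
  proof (cases "I = J")
    case False
    then have "\<delta> I - \<delta> J < 0" using assms(3)[OF that] by simp
    then have "filterlim (\<lambda>s. (\<delta> I - \<delta> J) * s) at_bot at_top"
      by (rule filterlim_tendsto_neg_mult_at_bot[OF tendsto_const _ filterlim_ident])
    then have "((\<lambda>s. exp ((\<delta> I - \<delta> J) * s)) \<longlongrightarrow> 0) at_top"
      by (rule filterlim_compose[OF exp_at_bot])
    then have "((\<lambda>s. complex_of_real (exp ((\<delta> I - \<delta> J) * s))) \<longlongrightarrow> of_real 0) at_top"
      by (rule tendsto_of_real)
    then have "((\<lambda>s. a I * exp (of_real (s * (\<delta> I - \<delta> J)))) \<longlongrightarrow> a I * 0) at_top"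
      by (intro tendsto_mult tendsto_const) (simp add: exp_of_real mult.commute flip: of_real_mult of_real_diff)
    then show ?thesis using False by simp
  qed simp
  then have "((\<lambda>s. \<Sum>I\<in>\<I>. a I * exp (of_real (s * (\<delta> I - \<delta> J)))) \<longlongrightarrow>
      (\<Sum>I\<in>\<I>. if I = J then a J else 0)) at_top"
    by (intro tendsto_sum)
  then show ?thesis using assms(1,2) by simp
qed

text \<open>An exchange argument: \<open>I\<close> and the initial segment have equally many
  elements outside each other, those of \<open>I\<close> having weight at most m - l - 1 and those
  of the segment at least m - l.\<close>

lemma sum_less_initial_segment:
  fixes D :: "'i::finite \<Rightarrow> real"
  assumes r: "inj_on r {..<m}" and D: "\<And>k. k < m \<Longrightarrow> D (r k) = real (m - k)"
    and D0: "\<And>i. i \<notin> r ` {..<m} \<Longrightarrow> D i \<le> 0"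
    and l: "l < m" and I: "card I = Suc l" "I \<noteq> r ` {..l}"
  shows "sum D I < sum D (r ` {..l})"
proof -
  let ?J = "r ` {..l}"
  have "inj_on r {..l}" by (rule inj_on_subset[OF r]) (use l in auto)
  then have cJ: "card ?J = Suc l" by (simp add: card_image)
  have split: "sum D A = sum D (A \<inter> B) + sum D (A - B)" for A B
    by (rule sum.Int_Diff) simp
  have "card I = card (I \<inter> ?J) + card (I - ?J)" "card ?J = card (?J \<inter> I) + card (?J - I)"
    by (rule card_Int_Diff, simp)+
  then have c: "card (?J - I) = card (I - ?J)"
    using I(1) cJ by (simp add: Int_commute)
  have ne: "card (I - ?J) \<noteq> 0"
  proof
    assume "card (I - ?J) = 0"
    moreover have "A = {}" if "card A = 0" for A :: "'i set" using that by simp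
    ultimately have "I - ?J = {}" "?J - I = {}" using c by metis+
    then show False using I(2) by blast
  qed
  have "sum D (I - ?J) \<le> real (card (I - ?J)) * (real (m - l) - 1)"
  proof (rule sum_bounded_above)
    fix i assume i: "i \<in> I - ?J"
    show "D i \<le> real (m - l) - 1"
    proof (cases "i \<in> r ` {..<m}")
      case True
      then obtain k where k: "k < m" "i = r k" by auto
      have "l < k"
      proof (rule ccontr)
        assume "\<not> l < k"
        then have "i \<in> ?J" using k(2) by auto
        then show False using i by simp
      qed
      then show ?thesis using D[OF k(1)] k by (simp add: of_nat_diff)
    next
      case False
      then show ?thesis using D0[OF False] l by (simp add: of_nat_diff)
    qed
  qed
  also have "\<dots> < real (card (I - ?J)) * real (m - l)"
    by (rule mult_strict_left_mono) (simp, use ne in linarith)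
  also have "\<dots> \<le> sum D (?J - I)"
    unfolding c[symmetric]
  proof (rule sum_bounded_below)
    fix i assume "i \<in> ?J - I"
    then obtain k where "k \<le> l" "i = r k" by auto
    then show "real (m - l) \<le> D i" using D[of k] l by (simp add: of_nat_diff)
  qed
  finally show ?thesis
    using split[of I ?J] split[of ?J I] by (simp add: Int_commute)
qed

section \<open>Holomorphy and independence\<close>

text \<open>The condition of \<open>holomorphic_on_submanifold\<close> at a single point, isolated
  to obtain closure under sums, products and composition.\<close>

definition cdiff :: "('i::finite phase \<Rightarrow> complex) \<Rightarrow> 'i phase \<Rightarrow> 'i phase set \<Rightarrow> bool" where
  "cdiff F x M \<longleftrightarrow> (\<exists>D. (F has_derivative D) (at x within M) \<and>
        (\<forall>c u v. D (c *s u, c *s v) = c * D (u, v)))"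

lemma cdiff_const: "cdiff (\<lambda>_. k) x M"
  unfolding cdiff_def by (intro exI[of _ "\<lambda>_. 0"]) simp

lemma cdiff_mult:
  assumes "cdiff F x M" "cdiff G x M"
  shows "cdiff (\<lambda>y. F y * G y) x M"
proof -
  obtain D D' where "(F has_derivative D) (at x within M)" "(G has_derivative D') (at x within M)"
    and lin: "\<And>c u v. D (c *s u, c *s v) = c * D (u, v)" "\<And>c u v. D' (c *s u, c *s v) = c * D' (u, v)"
    using assms unfolding cdiff_def by blast
  then have "((\<lambda>y. F y * G y) has_derivative (\<lambda>h. F x * D' h + D h * G x)) (at x within M)"
    by (intro has_derivative_mult)
  then show ?thesis
    unfolding cdiff_def
    by (intro exI[of _ "\<lambda>h. F x * D' h + D h * G x"] conjI) (simp_all add: lin algebra_simps)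
qed

lemma cdiff_sum:
  assumes "\<And>a. a \<in> A \<Longrightarrow> cdiff (F a) x M"
  shows "cdiff (\<lambda>y. \<Sum>a\<in>A. F a y) x M"
proof -
  have "\<forall>a\<in>A. \<exists>D. (F a has_derivative D) (at x within M) \<and>
        (\<forall>c u v. D (c *s u, c *s v) = c * D (u, v))"
    using assms unfolding cdiff_def by blast
  then obtain D where D: "\<And>a. a \<in> A \<Longrightarrow> (F a has_derivative D a) (at x within M)"
    "\<And>a c u v. a \<in> A \<Longrightarrow> D a (c *s u, c *s v) = c * D a (u, v)"
    by metis
  have "((\<lambda>y. \<Sum>a\<in>A. F a y) has_derivative (\<lambda>h. \<Sum>a\<in>A. D a h)) (at x within M)"
    by (intro has_derivative_sum D)
  then show ?thesis
    unfolding cdiff_def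
    by (intro exI[of _ "\<lambda>h. \<Sum>a\<in>A. D a h"] conjI) (simp_all add: D(2) sum_distrib_left)
qed

lemma cdiff_prod:
  assumes "finite A" "\<And>a. a \<in> A \<Longrightarrow> cdiff (F a) x M"
  shows "cdiff (\<lambda>y. \<Prod>a\<in>A. F a y) x M"
  using assms by (induction A rule: finite_induct) (simp_all add: cdiff_const cdiff_mult)

lemma cdiff_compose:
  assumes "cdiff F x M" "(f has_field_derivative f') (at (F x))"
  shows "cdiff (\<lambda>y. f (F y)) x M"
proof -
  obtain D where D: "(F has_derivative D) (at x within M)" "\<And>c u v. D (c *s u, c *s v) = c * D (u, v)"
    using assms(1) unfolding cdiff_def by blast
  have "((\<lambda>y. f (F y)) has_derivative (\<lambda>h. f' * D h)) (at x within M)"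
    using has_derivative_compose[OF D(1)] assms(2) by (simp add: has_field_derivative_def)
  then show ?thesis
    unfolding cdiff_def by (intro exI[of _ "\<lambda>h. f' * D h"] conjI) (simp_all add: D(2))
qed

lemma cdiff_coordinates: "cdiff (\<lambda>y. fst y $ i) x M" "cdiff (\<lambda>y. snd y $ i) x M"
proof -
  have "((\<lambda>y. fst y $ i) has_derivative (\<lambda>y. fst y $ i)) (at x within M)"
    "((\<lambda>y. snd y $ i) has_derivative (\<lambda>y. snd y $ i)) (at x within M)"
    by (intro bounded_linear_imp_has_derivative bounded_linear_compose[OF bounded_linear_vec_nth]
        bounded_linear_fst bounded_linear_snd)+
  then show "cdiff (\<lambda>y. fst y $ i) x M" "cdiff (\<lambda>y. snd y $ i) x M"
    unfolding cdiff_def by (auto intro!: exI)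
qed

lemma cdiff_diff:
  assumes "cdiff F x M" "cdiff G x M"
  shows "cdiff (\<lambda>y. F y - G y) x M"
proof -
  obtain D D' where "(F has_derivative D) (at x within M)" "(G has_derivative D') (at x within M)"
    and lin: "\<And>c u v. D (c *s u, c *s v) = c * D (u, v)" "\<And>c u v. D' (c *s u, c *s v) = c * D' (u, v)"
    using assms unfolding cdiff_def by blast
  then have "((\<lambda>y. F y - G y) has_derivative (\<lambda>h. D h - D' h)) (at x within M)"
    by (intro has_derivative_diff)
  then show ?thesis
    unfolding cdiff_def
    by (intro exI[of _ "\<lambda>h. D h - D' h"] conjI) (simp_all add: lin right_diff_distrib)
qed

lemma cdiff_transform:
  assumes "cdiff F x M" "x \<in> M" "\<And>y. y \<in> M \<Longrightarrow> G y = F y"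
  shows "cdiff G x M"
  using assms has_derivative_transform[of x M G F] unfolding cdiff_def by blast

lemma cdiff_imp_continuous_on:
  assumes "\<And>x. x \<in> M \<Longrightarrow> cdiff F x M"
  shows "continuous_on M F"
  using assms has_derivative_continuous unfolding cdiff_def continuous_on_eq_continuous_within by blast

context
  fixes \<beta> \<nu> \<gamma> :: complex and \<sigma> :: "'i::finite \<Rightarrow> 'i" and R :: "'i set"
  assumes nz: "\<beta> \<noteq> 0" "\<nu> \<noteq> 0" and inv: "\<sigma> \<circ> \<sigma> = id" and reps: "pair_representatives \<sigma> R"
begin

lemma cdiff_weight:
  assumes x: "x \<in> sigma_submanifold \<beta> \<nu> \<gamma> \<sigma>"
  shows "cdiff (\<lambda>y. weight (rs_y \<beta> y) (rs_w \<nu> \<gamma> y) I) x (sigma_submanifold \<beta> \<nu> \<gamma> \<sigma>)"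
    (is "cdiff _ x ?M")
proof -
  have y: "cdiff (\<lambda>z. rs_y \<beta> z i) x ?M" for i
    unfolding rs_y_def
    by (rule cdiff_compose[OF cdiff_mult[OF cdiff_const cdiff_coordinates(2)] DERIV_exp])
  have w: "cdiff (\<lambda>z. rs_w \<nu> \<gamma> z i k) x ?M" if ik: "i \<noteq> k" for i k
  proof (cases "\<sigma> i = i \<and> \<sigma> k = k")
    \<comment> \<open>For two fixed indices the root is constant on the submanifold, since there
      e^(nu (q_i - q_k)) = -1; no regularity of the root is available for this pair.\<close>
    case True
    have "rs_w \<nu> \<gamma> z i k = csqrt (1 - 4 * (sinh \<gamma>)\<^sup>2 * (-1) / (-1 - 1)\<^sup>2)" if "z \<in> ?M" for z
    proof -
      have "exp (\<nu> * fst z $ i) = - exp (\<nu> * fst z $ k)"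
        using sigma_locusD(4)[of z \<beta> \<nu> \<sigma> i k] that nz True ik by (simp add: sigma_submanifold_def)
      then have "exp (\<nu> * (fst z $ i - fst z $ k)) = -1"
        by (simp add: right_diff_distrib exp_diff)
      then show ?thesis by (simp add: rs_w_def rs_f_exp)
    qed
    then show ?thesis by (rule cdiff_transform[OF cdiff_const x])
  next
    case False
    let ?q = "fst x $ i - fst x $ k"
    have nr: "rs_f \<nu> \<gamma> ?q \<notin> \<real>\<^sub>\<le>\<^sub>0" and "\<not> congmod (rs_T \<nu>) (fst x $ i) (fst x $ k)"
      using x ik False by (auto simp: sigma_submanifold_def)
    then have "sinh (\<nu> * ?q / 2) \<noteq> 0"
      using sinh_eq_0_iff_congmod[OF nz(2)] by blast
    from cdiff_compose[OF cdiff_diff[OF cdiff_coordinates(1,1)] rs_f_has_field_derivative[OF this]]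
    have "cdiff (\<lambda>z. rs_f \<nu> \<gamma> (fst z $ i - fst z $ k)) x ?M" .
    from cdiff_compose[OF this has_field_derivative_csqrt[OF nr]] show ?thesis
      by (simp add: rs_w_def)
  qed
  show ?thesis
    unfolding weight_def cross_def by (intro cdiff_mult cdiff_prod y w) auto
qed

theorem rs_H_holomorphic:
  assumes "l \<le> CARD('i)"
  shows "holomorphic_on_submanifold (rs_H \<beta> \<nu> \<gamma> l) (sigma_submanifold \<beta> \<nu> \<gamma> \<sigma>)"
  unfolding holomorphic_on_submanifold_def cdiff_def[symmetric]
proof
  fix x assume x: "x \<in> sigma_submanifold \<beta> \<nu> \<gamma> \<sigma>"
  have "cdiff (\<lambda>y. \<Sum>I | card I = l. weight (rs_y \<beta> y) (rs_w \<nu> \<gamma> y) I) x (sigma_submanifold \<beta> \<nu> \<gamma> \<sigma>)"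
    by (intro cdiff_sum cdiff_weight x)
  then show "cdiff (rs_H \<beta> \<nu> \<gamma> l) x (sigma_submanifold \<beta> \<nu> \<gamma> \<sigma>)"
  proof (rule cdiff_transform[OF _ x])
    fix z assume "z \<in> sigma_submanifold \<beta> \<nu> \<gamma> \<sigma>"
    then have "z \<in> sigma_locus \<beta> \<nu> \<sigma>" by (simp add: sigma_submanifold_def)
    from rs_H_eq_rs_h[OF this nz inv reps assms]
    show "rs_H \<beta> \<nu> \<gamma> l z = (\<Sum>I | card I = l. weight (rs_y \<beta> z) (rs_w \<nu> \<gamma> z) I)"
      by (simp add: rs_h_eq_sum_weight)
  qed
qed

text \<open>Up to -beta / sqrt 2, on the locus this is the derivative of H_(l+1) in P_(r j). The
  column index starts at H_1 because H_0 is constant on the locus.\<close>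

definition momentum_matrix :: "(nat \<Rightarrow> 'i) \<Rightarrow> 'i phase \<Rightarrow> nat \<Rightarrow> nat \<Rightarrow> complex" where
  "momentum_matrix r x j l = (\<Sum>I | card I = Suc l. weight (rs_y \<beta> x) (rs_w \<nu> \<gamma> x) I *
      (of_bool (r j \<in> I) - of_bool (\<sigma> (r j) \<in> I)))"

text \<open>The equations in the rapidity directions alone form a square linear system for the
  coefficients.\<close>

lemma differentials_independent_if_leibniz:
  assumes x: "x \<in> sigma_submanifold \<beta> \<nu> \<gamma> \<sigma>" and r: "bij_betw r {..<m} R" and m: "m \<le> CARD('i)"
    and "leibniz m (momentum_matrix r x) \<noteq> 0"
  shows "differentials_independent \<sigma> R (rs_H \<beta> \<nu> \<gamma>) {1..m} x"
  unfolding differentials_independent_def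
proof (intro allI impI ballI)
  fix c l
  assume c: "\<forall>i\<in>R. (\<Sum>l\<in>{1..m}. c l * dQ \<sigma> i (rs_H \<beta> \<nu> \<gamma> l) x) = 0 \<and>
      (\<Sum>l\<in>{1..m}. c l * dP \<sigma> i (rs_H \<beta> \<nu> \<gamma> l) x) = 0" and l: "l \<in> {1..m}"
  have xl: "x \<in> sigma_locus \<beta> \<nu> \<sigma>" using x by (simp add: sigma_submanifold_def)
  have "c (Suc (l - 1)) = 0"
  proof (rule leibniz_nonzero_kernel[where c = "\<lambda>l. c (Suc l)"])
    fix j assume "j < m"
    then have i: "r j \<in> R" using r by (auto simp: bij_betw_def)
    have dP: "dP \<sigma> (r j) (rs_H \<beta> \<nu> \<gamma> (Suc l)) x = - \<beta> / of_real (sqrt 2) * momentum_matrix r x j l"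
      if "l < m" for l
    proof -
      have "momentum_matrix r x j l = occupation_sum (rs_y \<beta> x) (rs_w \<nu> \<gamma> x) (Suc l) (r j)
          - occupation_sum (rs_y \<beta> x) (rs_w \<nu> \<gamma> x) (Suc l) (\<sigma> (r j))"
        by (simp only: momentum_matrix_def occupation_sum_def right_diff_distrib sum_subtractf)
      moreover have "Suc l \<le> CARD('i)" using that m by simp
      ultimately show ?thesis
        using dP_rs_H[OF nz inv reps xl i, of "Suc l" \<gamma>] by simp
    qed
    have "(\<Sum>l\<in>{1..m}. c l * dP \<sigma> (r j) (rs_H \<beta> \<nu> \<gamma> l) x)
        = (\<Sum>l<m. c (Suc l) * dP \<sigma> (r j) (rs_H \<beta> \<nu> \<gamma> (Suc l)) x)"
      using sum.atLeast1_atMost_eq[of "\<lambda>l. c l * dP \<sigma> (r j) (rs_H \<beta> \<nu> \<gamma> l) x" m] by simp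
    also have "\<dots> = (\<Sum>l<m. - \<beta> / of_real (sqrt 2) * (momentum_matrix r x j l * c (Suc l)))"
      by (intro sum.cong refl) (simp add: dP)
    also have "\<dots> = - \<beta> / of_real (sqrt 2) * (\<Sum>l<m. momentum_matrix r x j l * c (Suc l))"
      by (rule sum_distrib_left[symmetric])
    finally show "(\<Sum>l<m. momentum_matrix r x j l * c (Suc l)) = 0"
      using c i nz by simp
  qed (use assms(4) l in auto)
  then show "c l = 0" using l by simp
qed

section \<open>Nonvanishing of the determinant on an open dense set\<close>

lemma continuous_on_leibniz_momentum_matrix:
  "continuous_on (sigma_submanifold \<beta> \<nu> \<gamma> \<sigma>) (\<lambda>x. leibniz m (momentum_matrix r x))"
  unfolding leibniz_def momentum_matrix_def
  by (intro continuous_intros cdiff_imp_continuous_on cdiff_weight)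

text \<open>Dividing by -beta makes e^(-beta theta_i) acquire the factor e^(s D_i). The parameter s
  is complex so that analytic continuation in it applies.\<close>

definition rapidity_shift :: "('i \<Rightarrow> real) \<Rightarrow> complex \<Rightarrow> 'i phase \<Rightarrow> 'i phase" where
  "rapidity_shift D s x = (fst x, snd x + (\<chi> i. s * (- of_real (D i) / \<beta>)))"

lemma rapidity_shift_in_submanifold:
  assumes "x \<in> sigma_submanifold \<beta> \<nu> \<gamma> \<sigma>" "\<And>i. D i + D (\<sigma> i) = 0"
  shows "rapidity_shift D s x \<in> sigma_submanifold \<beta> \<nu> \<gamma> \<sigma>"
proof -
  have "D (\<sigma> i) = - D i" for i using assms(2)[of i] by simp
  then have "snd (rapidity_shift D s x) $ i + snd (rapidity_shift D s x) $ \<sigma> i = snd x $ i + snd x $ \<sigma> i" for i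
    by (simp add: rapidity_shift_def)
  moreover have "snd (rapidity_shift D s x) $ i = snd x $ i" if "\<sigma> i = i" for i
    using assms(2)[of i] that by (simp add: rapidity_shift_def)
  moreover have "fst (rapidity_shift D s x) = fst x"
    by (simp add: rapidity_shift_def)
  ultimately show ?thesis
    using assms(1) unfolding sigma_submanifold_def sigma_locus_def mem_Collect_eq case_prod_beta by simp
qed

lemma weight_rapidity_shift:
  "weight (rs_y \<beta> (rapidity_shift D s x)) (rs_w \<nu> \<gamma> (rapidity_shift D s x)) I
     = weight (rs_y \<beta> x) (rs_w \<nu> \<gamma> x) I * exp (s * of_real (sum D I))"
proof -
  have y: "rs_y \<beta> (rapidity_shift D s x) i = rs_y \<beta> x i * exp (s * of_real (D i))" for i
    using nz by (simp add: rs_y_def rapidity_shift_def right_diff_distrib flip: exp_add)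
  have w: "rs_w \<nu> \<gamma> (rapidity_shift D s x) = rs_w \<nu> \<gamma> x"
    by (simp add: rs_w_def rapidity_shift_def fun_eq_iff)
  show ?thesis
    unfolding weight_def y w by (simp add: prod.distrib sum_distrib_left exp_sum)
qed

text \<open>After rescaling, the matrix tends for large real s to a triangular one with the weights
  of the sets r(0), ..., r(l) on the diagonal. A determinant vanishing for every s would make one of
  these weights zero.\<close>

lemma leibniz_momentum_matrix_shift_nonzero:
  assumes x: "x \<in> sigma_submanifold \<beta> \<nu> \<gamma> \<sigma>" and r: "bij_betw r {..<m} R"
    and D: "\<And>k. k < m \<Longrightarrow> D (r k) = real (m - k)" "\<And>i. i \<notin> R \<Longrightarrow> D i \<le> 0"
  shows "\<exists>s. leibniz m (momentum_matrix r (rapidity_shift D s x)) \<noteq> 0"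
proof (rule ccontr)
  assume "\<not> ?thesis"
  then have zero: "leibniz m (momentum_matrix r (rapidity_shift D s x)) = 0" for s by auto
  define J where "J l = r ` {..l}" for l
  define c :: "nat \<Rightarrow> 'i set \<Rightarrow> complex" where "c j I = of_bool (r j \<in> I) - of_bool (\<sigma> (r j) \<in> I)" for j I
  let ?wt = "weight (rs_y \<beta> x) (rs_w \<nu> \<gamma> x)"
  \<comment> \<open>Column l is divided by the growth rate of its dominant summand, that of
    \<open>J l\<close>.\<close>
  define B where "B s j l = momentum_matrix r (rapidity_shift D (of_real s) x) j l *
      exp (- (of_real s * of_real (sum D (J l))))" for s :: real and j l
  have inj: "inj_on r {..<m}" and im: "r ` {..<m} = R" using r by (auto simp: bij_betw_def)
  have Beq: "B s j l = (\<Sum>I | card I = Suc l. (?wt I * c j I) * exp (of_real (s * (sum D I - sum D (J l)))))" for s j l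
    unfolding B_def momentum_matrix_def weight_rapidity_shift sum_distrib_right c_def
  proof (intro sum.cong refl)
    fix I :: "'i set"
    have "exp (of_real (s * (sum D I - sum D (J l)))) =
        exp (of_real s * complex_of_real (sum D I)) * exp (- (of_real s * complex_of_real (sum D (J l))))"
      by (simp add: right_diff_distrib flip: exp_add)
    then show "?wt I * exp (of_real s * of_real (sum D I)) * (of_bool (r j \<in> I) - of_bool (\<sigma> (r j) \<in> I)) *
        exp (- (of_real s * of_real (sum D (J l)))) =
      ?wt I * (of_bool (r j \<in> I) - of_bool (\<sigma> (r j) \<in> I)) * exp (of_real (s * (sum D I - sum D (J l))))"
      by (simp only: mult_ac)
  qed
  have cardJ: "card (J l) = Suc l" if "l < m" for l
  proof -
    have "inj_on r {..l}" by (rule inj_on_subset[OF inj]) (use that in auto)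
    then show ?thesis by (simp add: J_def card_image)
  qed
  have lim: "((\<lambda>s. B s j l) \<longlongrightarrow> ?wt (J l) * c j (J l)) at_top" if "l < m" for j l
    unfolding Beq
  proof (rule tendsto_dominant_exponential)
    show "J l \<in> {I. card I = Suc l}" using cardJ[OF that] by simp
    show "sum D I < sum D (J l)" if "I \<in> {I. card I = Suc l}" "I \<noteq> J l" for I
      unfolding J_def
      by (rule sum_less_initial_segment[OF inj D(1)]) (use D(2) im \<open>l < m\<close> that in \<open>auto simp: J_def\<close>)
  qed simp
  have "((\<lambda>s. leibniz m (B s)) \<longlongrightarrow> leibniz m (\<lambda>j l. ?wt (J l) * c j (J l))) at_top"
    unfolding leibniz_def
  proof (intro tendsto_sum tendsto_mult tendsto_const tendsto_prod lim)
    fix p i assume "p \<in> {p. p permutes {0..<m}}" "i \<in> {0..<m}"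
    then show "p i < m" using permutes_in_image[of p "{0..<m}" i] by auto
  qed
  moreover have "leibniz m (B s) = 0" for s
    unfolding B_def[abs_def] leibniz_scale_columns zero by simp
  ultimately have "leibniz m (\<lambda>j l. ?wt (J l) * c j (J l)) = 0"
    by (simp add: tendsto_const_iff)
  \<comment> \<open>\<open>J l\<close> lies in \<open>R\<close>, which contains no reflected
    representative, so the second indicator vanishes and the first yields the triangular
    shape.\<close>
  moreover have cJ: "c j (J l) = of_bool (j \<le> l)" if "j < m" "l < m" for j l
  proof -
    have "r j \<in> R" using that im by auto
    then have "\<sigma> (r j) \<notin> R" using reps by (auto simp: pair_representatives_def)
    moreover have "J l \<subseteq> R" using that im by (auto simp: J_def)
    moreover have "r j \<in> J l \<longleftrightarrow> j \<le> l"
      using inj that unfolding J_def by (auto dest: inj_onD)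
    ultimately show ?thesis by (auto simp: c_def)
  qed
  ultimately have "(\<Prod>l<m. ?wt (J l) * c l (J l)) = 0"
    by (subst (asm) leibniz_upper_triangular) auto
  then obtain l where l: "l < m" "?wt (J l) = 0"
    using cJ by auto
  \<comment> \<open>Each factor pairs an index of \<open>R\<close>, which is moved by sigma, with
    another one; there \<open>f\<close> avoids the cut and in particular 0.\<close>
  have "?wt (J l) \<noteq> 0"
  proof -
    have "rs_w \<nu> \<gamma> x i k \<noteq> 0" if "i \<in> J l" "k \<in> - J l" for i k
    proof -
      have "i \<in> R" using that im l by (auto simp: J_def)
      then have "\<sigma> i \<noteq> i" using reps by (auto simp: pair_representatives_def)
      moreover have "i \<noteq> k" using that by auto
      ultimately have "rs_f \<nu> \<gamma> (fst x $ i - fst x $ k) \<notin> \<real>\<^sub>\<le>\<^sub>0"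
        using x by (simp add: sigma_submanifold_def)
      then show ?thesis by (auto simp: rs_w_def)
    qed
    then show ?thesis by (simp add: weight_def cross_def rs_y_def)
  qed
  then show False using l by simp
qed

lemma leibniz_momentum_matrix_dense:
  assumes x: "x \<in> sigma_submanifold \<beta> \<nu> \<gamma> \<sigma>" and r: "bij_betw r {..<m} R"
  shows "x \<in> closure {z \<in> sigma_submanifold \<beta> \<nu> \<gamma> \<sigma>. leibniz m (momentum_matrix r z) \<noteq> 0}"
proof -
  have invo: "\<sigma> (\<sigma> i) = i" for i using inv by (metis comp_apply id_apply)
  have R: "R \<inter> \<sigma> ` R = {}" "R \<union> \<sigma> ` R = {i. \<sigma> i \<noteq> i}"
    using reps by (auto simp: pair_representatives_def)
  define idx where "idx = the_inv_into {..<m} r"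
  have idx: "idx (r k) = k" if "k < m" for k
    using r that by (simp add: idx_def bij_betw_def the_inv_into_f_f)
  have idx_less: "idx i < m" if "i \<in> R" for i
    using r that idx by (auto simp: bij_betw_def)
  \<comment> \<open>The weights m, ..., 1 on the representatives, continued oddly under sigma so
    that the shift preserves the submanifold.\<close>
  define D where "D i = (if i \<in> R then real (m - idx i) else if \<sigma> i \<in> R then - real (m - idx (\<sigma> i)) else 0)" for i
  have sR: "\<sigma> i \<notin> R" if "i \<in> R" for i using R(1) that by auto
  have D1: "D (r k) = real (m - k)" if "k < m" for k
    using r that idx by (auto simp: D_def bij_betw_def)
  have D2: "D i \<le> 0" if "i \<notin> R" for i using that by (simp add: D_def)
  have D3: "D i + D (\<sigma> i) = 0" for i
    using sR[of i] sR[of "\<sigma> i"] invo[of i] by (auto simp: D_def)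
  let ?G = "\<lambda>s. leibniz m (momentum_matrix r (rapidity_shift D s x))"
  have hol: "?G holomorphic_on UNIV"
    unfolding leibniz_def momentum_matrix_def weight_rapidity_shift
    by (intro holomorphic_intros)
  have freq: "\<exists>\<^sub>F s in at 0. ?G s \<noteq> 0"
  proof (rule ccontr)
    assume "\<not> ?thesis"
    then have "\<forall>\<^sub>F s in at 0. ?G s = 0" by (simp add: not_frequently)
    then obtain e where e: "e > 0" "\<And>s. s \<noteq> 0 \<Longrightarrow> dist s 0 < e \<Longrightarrow> ?G s = 0"
      by (auto simp: eventually_at)
    \<comment> \<open>By the identity theorem, vanishing on a punctured disc around 0 would make the
      determinant vanish for every s.\<close>
    have "(0::complex) islimpt ball 0 e - {0}"
      using e(1) by (simp add: islimpt_punctured[symmetric] islimpt_ball)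
    then have "?G s = 0" for s
      by (rule analytic_continuation[OF hol open_UNIV connected_UNIV subset_UNIV UNIV_I])
         (use e(2) in \<open>auto simp: dist_commute\<close>)
    then show False
      using leibniz_momentum_matrix_shift_nonzero[OF x r D1 D2] by auto
  qed
  have "((\<lambda>s. (\<chi> i. s * (- of_real (D i) / \<beta>)) :: complex ^ 'i) \<longlongrightarrow> (\<chi> i. 0 * (- of_real (D i) / \<beta>))) (at 0)"
    by (rule vec_tendstoI, unfold vec_lambda_beta, rule tendsto_mult_right, rule tendsto_ident_at)
  then have "((\<lambda>s. rapidity_shift D s x) \<longlongrightarrow> rapidity_shift D 0 x) (at 0)"
    unfolding rapidity_shift_def by (intro tendsto_Pair tendsto_add tendsto_const)
  moreover have "rapidity_shift D 0 x = x"
    by (simp add: rapidity_shift_def Finite_Cartesian_Product.vec_eq_iff prod_eq_iff)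
  ultimately have tends: "((\<lambda>s. rapidity_shift D s x) \<longlongrightarrow> x) (at 0)" by simp
  show ?thesis
    unfolding closure_approachable
  proof (intro allI impI)
    fix e :: real assume "e > 0"
    then have "\<forall>\<^sub>F s in at 0. dist (rapidity_shift D s x) x < e"
      using tends by (simp add: tendsto_iff)
    then have "\<exists>\<^sub>F s in at 0. ?G s \<noteq> 0 \<and> dist (rapidity_shift D s x) x < e"
      by (rule frequently_eventually_frequently[OF freq])
    then obtain s where "?G s \<noteq> 0" "dist (rapidity_shift D s x) x < e"
      by (auto dest: frequently_ex)
    then show "\<exists>z\<in>{z \<in> sigma_submanifold \<beta> \<nu> \<gamma> \<sigma>. leibniz m (momentum_matrix r z) \<noteq> 0}. dist z x < e"
      using rapidity_shift_in_submanifold[where D = D and s = s, OF x] D3 by blast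
  qed
qed

end

section \<open>Assembly of the integrable hierarchy\<close>

theorem mainTheorem2:
  fixes \<beta> \<nu> \<gamma> :: complex and n :: nat
    and \<sigma> :: "'i::finite \<Rightarrow> 'i" and R :: "'i set"
  assumes "\<beta> \<noteq> 0" and "\<nu> \<noteq> 0"
    and "CARD('i) = n + 1"
    and "\<sigma> \<circ> \<sigma> = id"
    and "card {i. \<sigma> i = i} \<le> 2"
    and "pair_representatives \<sigma> R"
  shows "integrable_hierarchy \<sigma> R (sigma_submanifold \<beta> \<nu> \<gamma> \<sigma>)
           (\<lambda>l. rs_H \<beta> \<nu> \<gamma> l) {0..(n + 1) div 2}"
proof -
  note ctx = assms(1,2,4,6)
  let ?M = "sigma_submanifold \<beta> \<nu> \<gamma> \<sigma>"
  have le: "l \<le> CARD('i)" if "l \<in> {0..(n + 1) div 2}" for l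
    using that assms(3) by auto
  define m where "m = card R"
  \<comment> \<open>The representatives make up at most half of the indices, so H_1, ..., H_m all
    belong to the hierarchy; these serve as the independent family.\<close>
  have "2 * m \<le> n + 1"
  proof -
    have inv: "\<sigma> (\<sigma> i) = i" for i using assms(4) by (metis comp_apply id_apply)
    then have "card (\<sigma> ` R) = card R" by (intro card_image) (metis inj_onI)
    then have "card (R \<union> \<sigma> ` R) = 2 * m"
      using assms(6) by (subst card_Un_disjoint) (auto simp: pair_representatives_def m_def)
    then show ?thesis using card_mono[OF finite subset_UNIV, of "R \<union> \<sigma> ` R"] assms(3) by simp
  qed
  then have S: "{1..m} \<subseteq> {0..(n + 1) div 2}" and mle: "m \<le> CARD('i)"
    using assms(3) by auto
  obtain r where r: "bij_betw r {..<m} R"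
    using ex_bij_betw_nat_finite[of R] by (auto simp: m_def atLeast0LessThan)
  define U where "U = {z \<in> ?M. leibniz m (momentum_matrix \<beta> \<nu> \<gamma> \<sigma> r z) \<noteq> 0}"
  have "openin (top_of_set ?M) (?M \<inter> (\<lambda>z. leibniz m (momentum_matrix \<beta> \<nu> \<gamma> \<sigma> r z)) -` (- {0}))"
    by (intro continuous_openin_preimage_gen continuous_on_leibniz_momentum_matrix[OF ctx]) auto
  also have "?M \<inter> (\<lambda>z. leibniz m (momentum_matrix \<beta> \<nu> \<gamma> \<sigma> r z)) -` (- {0}) = U"
    by (auto simp: U_def)
  finally have "openin (top_of_set ?M) U" .
  moreover have "?M \<subseteq> closure U"
    unfolding U_def using leibniz_momentum_matrix_dense[OF ctx _ r] by blast
  moreover have "differentials_independent \<sigma> R (\<lambda>l. rs_H \<beta> \<nu> \<gamma> l) {1..m} x" if "x \<in> U" for x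
    using differentials_independent_if_leibniz[OF ctx _ r mle] that by (simp add: U_def)
  ultimately have "\<exists>S\<subseteq>{0..(n + 1) div 2}. card S = card R \<and>
      (\<exists>U. openin (top_of_set ?M) U \<and> ?M \<subseteq> closure U \<and>
        (\<forall>x\<in>U. differentials_independent \<sigma> R (\<lambda>l. rs_H \<beta> \<nu> \<gamma> l) S x))"
    by (intro exI[of _ "{1..m}"] conjI S exI[of _ U]) (auto simp: m_def)
  then show ?thesis
    unfolding integrable_hierarchy_def
    using rs_H_holomorphic[OF ctx le] rest_bracket_rs_H_eq_0[OF ctx _ le le] by blast
qed

end
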